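(* Let $Q_0 \subset \mathbb{R}^n$ be a bounded cube and let $1 < p < \infty$. Then there exists a nonnegative function $f$ on $Q_0$ such that $f^{1/q} \notin JN_q(Q_0)$ whenever $1 < q \leq p$, and $f^{1/q} \in JN_q(Q_0)$ for every $q \in (p,\infty)$.
   Context: All cubes in $\mathbb{R}^n$ have edges parallel to the coordinate axes. For an integrable function $h$ on a cube $Q$ write $h_Q := \frac{1}{|Q|}\int_Q h$. For a bounded cube $Q_0 \subset \mathbb{R}^n$ and $1<q<\infty$, a function $h$ belongs to $JN_q(Q_0)$ if $h \in L^1(Q_0)$ and there is a constant $K<\infty$ such that $\sum_{i=1}^\infty |Q_i| \left( \frac{1}{|Q_i|}\int_{Q_i} |h - h_{Q_i}| \right)^q \leq K^q$ for all countable collections of pairwise disjoint cubes $(Q_i)_{i=1}^\infty$ contained in $Q_0$. *)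

theory Defs
  imports "HOL-Analysis.Analysis"
begin

text \<open>
  A cube is a product of intervals of a common length \<open>l > 0\<close>. Each of the intervals
  may independently be open, closed or half-open, so that no convention about the faces
  of a cube is imposed.
\<close>

definition is_cube :: "(real ^ 'n) set \<Rightarrow> bool" where
  "is_cube Q \<longleftrightarrow>
     (\<exists>a l I. 0 < l \<and>
        (\<forall>i. {a $ i <..< a $ i + l} \<subseteq> I i \<and> I i \<subseteq> {a $ i .. a $ i + l}) \<and>
        Q = {x. \<forall>i. x $ i \<in> I i})"

definition mean :: "(real ^ 'n) set \<Rightarrow> (real ^ 'n \<Rightarrow> real) \<Rightarrow> real" where
  "mean Q h = (1 / measure lebesgue Q) * (LINT x:Q|lebesgue. h x)"

text \<open>
  The sum over the family is taken in \<^typ>\<open>ennreal\<close>, so a divergent sum is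
  \<open>\<infinity>\<close> and violates the bound. Disjoint cubes are distinct, so a family is the same as
  a set of cubes.
\<close>

definition JN :: "real \<Rightarrow> (real ^ 'n) set \<Rightarrow> (real ^ 'n \<Rightarrow> real) set" where
  "JN q Q\<^sub>0 = {h. set_integrable lebesgue Q\<^sub>0 h \<and>
     (\<exists>K\<ge>0. \<forall>\<C>. countable \<C> \<longrightarrow> pairwise disjnt \<C> \<longrightarrow> (\<forall>Q\<in>\<C>. is_cube Q \<and> Q \<subseteq> Q\<^sub>0) \<longrightarrow>
        (\<Sum>\<^sub>\<infinity>Q\<in>\<C>. ennreal (measure lebesgue Q * (mean Q (\<lambda>x. \<bar>h x - mean Q h\<bar>)) powr q))
          \<le> ennreal (K powr q))}"

end

theory Submission
  imports Defs
begin

text \<open>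
  The function \<open>f\<close> depends on a single coordinate and is a small perturbation of a
  step function \<open>G\<close> whose roots \<open>G^(1/q)\<close> lie in \<open>JN q\<close>
  for every \<open>q > 1\<close> although \<open>G\<close> is not integrable.

  Let \<open>K\<close> be the Cantor set obtained from \<open>[0,1]\<close> by removing the middle half of every
  interval, over and over again, and let \<open>G = 2^k\<close> on the gaps removed at step \<open>k\<close>. The
  \<open>k\<close>-th approximation of \<open>K\<close> has length \<open>2^-k\<close>, so each step contributes the same
  amount to the integral of \<open>G\<close>, which diverges. The oscillation of \<open>G^(1/q)\<close> nevertheless
  is controlled by a finite measure, the natural probability measure \<open>\<mu>\<close> on \<open>K\<close>: an
  interval that misses \<open>K\<close> lies in a gap and sees no oscillation at all, and for every
  interval \<open>I\<close> in \<open>[0,1]\<close> the quantity \<open>|I| osc(I)^q\<close> is at most a constant times \<open>\<mu>(I)\<close>.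
  This bound is invariant under the two similarities that generate \<open>K\<close>, so it suffices to
  know it for intervals that cross the middle gap. There, \<open>G\<close> differs from \<open>1\<close> only
  on a piece at the right end of the left child and a piece at the left end of the right child,
  and both of these pieces are initial or final intervals of a copy of \<open>[0,1]\<close>, for which
  the bound is once more a matter of scaling. As \<open>\<mu>\<close> is only ever compared with finitely many
  intervals at a time, it is replaced by the densities of its finite approximations.
  The outcome is \<open>controlled_interval\<close>.

  The exponent \<open>p\<close> enters through a ripple: on one half of each gap of step \<open>k\<close> the
  value of \<open>G\<close> is multiplied by \<open>2^\<epsilon>\<close> with \<open>\<epsilon> = (k+1)^(-1/p)\<close>. This changes
  \<open>G^(1/q)\<close> by at most \<open>\<epsilon> G^(1/q)\<close>, whose \<open>q\<close>-th power has an integral of the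
  order of the sum of the \<open>\<epsilon>^q = (k+1)^(-q/p)\<close>. For \<open>q > p\<close> that sum is finite, the
  change is a function in \<open>L^q\<close>, and membership in \<open>JN q\<close> survives
  (\<open>coordinate_profile_in_JN\<close>). For \<open>q \<le> p\<close> the slab over each gap contains disjoint
  cubes that have the width of the gap and fill a fixed proportion of the slab; over all gaps of
  step \<open>k\<close> they contribute a constant times \<open>(k+1)^(-q/p)\<close>, cubes of different steps
  are disjoint, and the series diverges (\<open>coordinate_profile_notin_JN\<close>).
\<close>

section \<open>Integrals over intervals of the real line\<close>

lemma set_integral_mono_superset:
  fixes \<phi> :: "real \<Rightarrow> real"
  assumes "set_integrable lborel B \<phi>" "A \<subseteq> B" "A \<in> sets borel" "\<And>t. t \<in> B \<Longrightarrow> 0 \<le> \<phi> t"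
  shows "(LINT t:A|lborel. \<phi> t) \<le> (LINT t:B|lborel. \<phi> t)"
  unfolding set_lebesgue_integral_def
proof (rule integral_mono)
  show "integrable lborel (\<lambda>t. indicat_real A t *\<^sub>R \<phi> t)"
    using set_integrable_subset[OF assms(1), of A] assms by (simp add: set_integrable_def)
qed (use assms in \<open>auto simp: set_integrable_def indicator_def\<close>)

lemma set_integral_nonneg:
  fixes \<phi> :: "'a \<Rightarrow> real"
  assumes "\<And>t. t \<in> A \<Longrightarrow> 0 \<le> \<phi> t"
  shows "0 \<le> (LINT t:A|M. \<phi> t)"
  unfolding set_lebesgue_integral_def
  by (intro Bochner_Integration.integral_nonneg) (use assms in \<open>auto simp: indicator_def\<close>)

lemma set_integral_affine:
  fixes \<phi> :: "real \<Rightarrow> real"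
  assumes "0 < r"
  shows "(LINT t:{u..v}|lborel. \<phi> (r * t + b)) = (LINT t:{r * u + b..r * v + b}|lborel. \<phi> t) / r"
proof -
  have *: "indicat_real {r * u + b..r * v + b} (b + r * t) = indicator {u..v} t" for t
    using assms by (auto simp: indicator_def)
  have "(LINT t:{r * u + b..r * v + b}|lborel. \<phi> t)
      = \<bar>r\<bar> *\<^sub>R (\<integral>t. indicator {r * u + b..r * v + b} (b + r * t) *\<^sub>R \<phi> (b + r * t) \<partial>lborel)"
    unfolding set_lebesgue_integral_def using assms by (subst lborel_integral_real_affine[of r]) auto
  then show ?thesis
    using assms unfolding * set_lebesgue_integral_def by (simp add: add.commute)
qed

lemma set_integral_reflect:
  fixes \<phi> :: "real \<Rightarrow> real"
  shows "(LINT t:{1 - v..1 - u}|lborel. \<phi> t) = (LINT t:{u..v}|lborel. \<phi> (1 - t))"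
proof -
  have *: "indicat_real {1 - v..1 - u} (1 + -1 * t) = indicator {u..v} t" for t
    by (auto simp: indicator_def)
  show ?thesis
    unfolding set_lebesgue_integral_def
    by (subst lborel_integral_real_affine[of "-1" _ 1]) (simp_all only: *, simp_all)
qed

lemma set_integral_rescale:
  fixes \<phi> \<psi> :: "real \<Rightarrow> real"
  assumes "\<And>t. t \<in> {u..v} \<Longrightarrow> \<phi> t = d * \<psi> (4 * t + b)"
  shows "(LINT t:{u..v}|lborel. \<phi> t) = d / 4 * (LINT t:{4 * u + b..4 * v + b}|lborel. \<psi> t)"
proof -
  have "(LINT t:{u..v}|lborel. \<phi> t) = (LINT t:{u..v}|lborel. d * \<psi> (4 * t + b))"
    using assms by (intro set_lebesgue_integral_cong) auto
  also have "\<dots> = d * (LINT t:{u..v}|lborel. \<psi> (4 * t + b))" by simp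
  finally show ?thesis by (simp add: set_integral_affine)
qed

lemma powr_add_le:
  fixes a b q :: real
  assumes "0 \<le> a" "0 \<le> b" "0 < q"
  shows "(a + b) powr q \<le> 2 powr q * (a powr q + b powr q)"
proof -
  have "(a + b) powr q \<le> (2 * max a b) powr q"
    using assms by (intro powr_mono2) auto
  also have "\<dots> = 2 powr q * max a b powr q"
    using assms by (simp add: powr_mult)
  also have "\<dots> \<le> 2 powr q * (a powr q + b powr q)"
    by (intro mult_left_mono) (auto simp: max_def)
  finally show ?thesis .
qed

lemma integrable_indicator_interval: "integrable lborel (indicat_real {a..b::real})"
  by (intro integrable_real_indicator) (auto simp: emeasure_lborel_Icc_eq)

lemma set_integrable_const_interval: "set_integrable lborel {a..b::real} (\<lambda>t. c :: real)"
  unfolding set_integrable_def real_scaleR_def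
  by (intro integrable_mult_left integrable_indicator_interval)

text \<open>
  Jensen's inequality for the power function, by integrating the tangent to \<open>x^q\<close> at the mean
  value of \<open>\<phi>\<close>.
\<close>

lemma power_mean_inequality:
  fixes \<phi> :: "real \<Rightarrow> real"
  assumes q: "1 < q" and uv: "u < v" and nonneg: "\<And>t. 0 \<le> \<phi> t"
    and int: "set_integrable lborel {u..v} \<phi>" "set_integrable lborel {u..v} (\<lambda>t. \<phi> t powr q)"
  shows "(v - u) * ((LINT t:{u..v}|lborel. \<phi> t) / (v - u)) powr q \<le> (LINT t:{u..v}|lborel. \<phi> t powr q)"
proof -
  define m where "m = (LINT t:{u..v}|lborel. \<phi> t) / (v - u)"
  have "0 \<le> m" unfolding m_def using uv nonneg by (intro divide_nonneg_pos set_integral_nonneg) auto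
  show ?thesis
  proof (cases "m = 0")
    case True
    then have "(v - u) * m powr q = 0" by simp
    moreover have "0 \<le> (LINT t:{u..v}|lborel. \<phi> t powr q)" by (intro set_integral_nonneg) simp
    ultimately show ?thesis unfolding m_def[symmetric] by linarith
  next
    case False
    with \<open>0 \<le> m\<close> have m: "0 < m" by simp
    define d where "d = q * m powr (q - 1)"
    \<comment> \<open>The tangent at \<open>m > 0\<close> lies below the graph, also at the boundary point \<open>0\<close>.\<close>
    have tangent: "m powr q + d * (x - m) \<le> x powr q" if "0 \<le> x" for x
    proof (cases "x = 0")
      case True
      have "d * m = q * m powr q"
        using m powr_add[of m "q - 1" 1] by (simp add: d_def)
      moreover have "1 * m powr q \<le> q * m powr q"
        using q by (intro mult_right_mono) auto
      ultimately have "m powr q \<le> d * m" by linarith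
      then show ?thesis by (simp add: True)
    next
      case False
      have der: "((\<lambda>x. x powr q) has_real_derivative d) (at m within {0<..})"
        unfolding d_def by (rule has_field_derivative_at_within[OF has_real_derivative_powr[OF m]])
      have "m \<in> interior {0<..}" "x \<in> {0<..}" "1 \<le> q"
        using m False that q by (simp_all add: interior_open)
      then have "x powr q - m powr q \<ge> d * (x - m)"
        using convex_on_imp_above_tangent[OF powr_convex _ _ _ der] by simp
      then show ?thesis by simp
    qed
    have c: "set_integrable lborel {u..v} (\<lambda>t. c)" for c :: real
      by (rule set_integrable_const_interval)
    have cI: "(LINT t:{u..v}|lborel. c) = (v - u) * c" for c :: real
      using uv by (simp add: set_lebesgue_integral_def)
    have i: "set_integrable lborel {u..v} (\<lambda>t. d * (\<phi> t - m))"
      by (intro set_integrable_mult_right set_integral_diff(1) int(1) c)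
    have "(LINT t:{u..v}|lborel. \<phi> t - m) = 0"
      unfolding set_integral_diff(2)[OF int(1) c] cI using uv by (simp add: m_def)
    then have "(v - u) * m powr q = (LINT t:{u..v}|lborel. m powr q + d * (\<phi> t - m))"
      unfolding set_integral_add(2)[OF c i] cI set_integral_mult_right by simp
    also have "\<dots> \<le> (LINT t:{u..v}|lborel. \<phi> t powr q)"
      by (intro set_integral_mono[OF set_integral_add(1)[OF c i] int(2)] tangent nonneg)
    finally show ?thesis unfolding m_def .
  qed
qed

text \<open>
  The mean is as good a constant as any other, up to a factor of two; so upper bounds for the
  oscillation may be computed with whichever constant is convenient.
\<close>

lemma mean_oscillation_le:
  fixes \<phi> :: "real \<Rightarrow> real"
  assumes uv: "u < v" and int: "set_integrable lborel {u..v} \<phi>"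
  shows "(LINT t:{u..v}|lborel. \<bar>\<phi> t - (LINT t:{u..v}|lborel. \<phi> t) / (v - u)\<bar>)
    \<le> 2 * (LINT t:{u..v}|lborel. \<bar>\<phi> t - c\<bar>)"
proof -
  define m where "m = (LINT t:{u..v}|lborel. \<phi> t) / (v - u)"
  define J where "J = (LINT t:{u..v}|lborel. \<bar>\<phi> t - c\<bar>)"
  have c: "set_integrable lborel {u..v} (\<lambda>t. c)" for c :: real
    by (rule set_integrable_const_interval)
  have cI: "(LINT t:{u..v}|lborel. c) = (v - u) * c" for c :: real
    using uv by (simp add: set_lebesgue_integral_def)
  have abs_int: "set_integrable lborel {u..v} (\<lambda>t. \<bar>\<phi> t - c\<bar>)" for c
    by (intro set_integrable_abs set_integral_diff int c)
  have "(v - u) * (m - c) = (LINT t:{u..v}|lborel. \<phi> t - c)"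
  proof -
    have "(v - u) * m = (LINT t:{u..v}|lborel. \<phi> t)" using uv by (simp add: m_def)
    then show ?thesis unfolding set_integral_diff(2)[OF int c] cI by (simp add: right_diff_distrib)
  qed
  also have "\<bar>\<dots>\<bar> \<le> J"
    unfolding J_def set_lebesgue_integral_def
    by (rule order.trans[OF integral_abs_bound]) (simp add: abs_mult)
  finally have m: "(v - u) * \<bar>m - c\<bar> \<le> J" using uv by (simp add: abs_mult)
  have "(LINT t:{u..v}|lborel. \<bar>\<phi> t - m\<bar>) \<le> (LINT t:{u..v}|lborel. \<bar>\<phi> t - c\<bar> + \<bar>m - c\<bar>)"
    by (intro set_integral_mono abs_int set_integral_add c) auto
  also have "\<dots> = J + (v - u) * \<bar>m - c\<bar>"
    unfolding set_integral_add(2)[OF abs_int c] cI J_def ..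
  finally show ?thesis using m unfolding m_def J_def by simp
qed

section \<open>The middle-half Cantor set\<close>

text \<open>
  The approximations are generated from the outside inwards, by the inverses \<open>4 t\<close> and
  \<open>4 t - 3\<close> of the two similarities. This turns every scaling argument below into a single
  unfolding of the recursion.
\<close>

primrec cantor :: "nat \<Rightarrow> real set" where
  "cantor 0 = {0..1}"
| "cantor (Suc k) = {t. 4 * t \<in> cantor k \<or> 4 * t - 3 \<in> cantor k}"

text \<open>
  The step at which \<open>t\<close> is removed. On the Cantor set itself this is an arbitrary number.
\<close>

definition level :: "real \<Rightarrow> nat" where
  "level t = (LEAST k. t \<notin> cantor (Suc k))"

text \<open>
  Step functions that are constant on the gaps of each step. The value \<open>0\<close> on the Cantor set
  makes the scaling rules below hold at every point rather than almost everywhere.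
\<close>

definition on_levels :: "(nat \<Rightarrow> real) \<Rightarrow> real \<Rightarrow> real" where
  "on_levels c t = (if \<forall>k. t \<in> cantor k then 0 else c (level t))"

text \<open>
  The density, of total mass one, of the \<open>k\<close>-th approximation of the Cantor measure.
\<close>

definition cantor_density :: "nat \<Rightarrow> real \<Rightarrow> real" where
  "cantor_density k t = 2 ^ k * indicator (cantor k) t"

lemma cantor_subset_unit: "cantor k \<subseteq> {0..1}"
  by (induction k) auto

lemma cantor_Suc_subset: "cantor (Suc k) \<subseteq> cantor k"
proof (induction k)
  case 0
  then show ?case by auto
next
  case (Suc k)
  show ?case
  proof
    fix t assume "t \<in> cantor (Suc (Suc k))"
    then have "4 * t \<in> cantor (Suc k) \<or> 4 * t - 3 \<in> cantor (Suc k)"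
      by (subst (asm) cantor.simps(2)) simp
    with Suc have "4 * t \<in> cantor k \<or> 4 * t - 3 \<in> cantor k" by blast
    then show "t \<in> cantor (Suc k)" by simp
  qed
qed

lemma cantor_antimono: "j \<le> k \<Longrightarrow> cantor k \<subseteq> cantor j"
  using cantor_Suc_subset by (rule lift_Suc_antimono_le)

lemma cantor_Suc_left:
  assumes "t \<le> 1/4" shows "t \<in> cantor (Suc k) \<longleftrightarrow> 4 * t \<in> cantor k"
  using cantor_subset_unit[of k] assms by fastforce

lemma cantor_Suc_right:
  assumes "3/4 \<le> t" shows "t \<in> cantor (Suc k) \<longleftrightarrow> 4 * t - 3 \<in> cantor k"
  using cantor_subset_unit[of k] assms by fastforce

lemma cantor_reflect: "1 - t \<in> cantor k \<longleftrightarrow> t \<in> cantor k"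
proof (induction k arbitrary: t)
  case (Suc k)
  have "4 * (1 - t) \<in> cantor k \<longleftrightarrow> 4 * t - 3 \<in> cantor k"
    using Suc[of "4 * t - 3"] by (simp add: algebra_simps)
  moreover have "4 * (1 - t) - 3 \<in> cantor k \<longleftrightarrow> 4 * t \<in> cantor k"
    using Suc[of "4 * t"] by (simp add: algebra_simps)
  ultimately show ?case by auto
qed auto

lemma cantor_measurable [measurable]: "cantor k \<in> sets borel"
proof (induction k)
  case (Suc k)
  note [measurable] = Suc
  show ?case by simp
qed auto

lemma level_measurable [measurable]: "level \<in> borel \<rightarrow>\<^sub>M count_space UNIV"
  unfolding level_def[abs_def] by measurable

lemma on_levels_measurable [measurable]: "on_levels c \<in> borel_measurable borel"
proof -
  have [measurable]: "c \<in> count_space UNIV \<rightarrow>\<^sub>M borel" by simp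
  show ?thesis unfolding on_levels_def[abs_def] by measurable
qed

lemma cantor_density_measurable [measurable]: "cantor_density k \<in> borel_measurable borel"
  unfolding cantor_density_def[abs_def] by measurable

declare cantor.simps(2) [simp del]

lemma level_eqI:
  assumes "t \<in> cantor k" "t \<notin> cantor (Suc k)" shows "level t = k"
  unfolding level_def
proof (rule Least_equality)
  fix j assume "t \<notin> cantor (Suc j)"
  with assms cantor_antimono[of "Suc j" k] show "k \<le> j" by fastforce
qed (fact assms)

lemma level_mem:
  assumes "t \<in> {0..1}" "t \<notin> cantor j"
  shows "t \<in> cantor (level t)" "t \<notin> cantor (Suc (level t))"
proof -
  obtain i where "j = Suc i" using assms by (cases j) auto
  then show "t \<notin> cantor (Suc (level t))"
    using assms unfolding level_def by (metis LeastI)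
  show "t \<in> cantor (level t)"
  proof (cases "level t")
    case (Suc i)
    then have "\<not> (t \<notin> cantor (Suc i))"
      unfolding level_def by (metis lessI not_less_Least)
    then show ?thesis using Suc by simp
  qed (use assms in auto)
qed

lemma on_levels_eq:
  assumes "t \<in> cantor k" "t \<notin> cantor (Suc k)" shows "on_levels c t = c k"
  using level_eqI[OF assms] assms(2) unfolding on_levels_def by auto

text \<open>
  A similarity moves each gap by one step, hence it shifts the sequence of values.
\<close>

lemma on_levels_shift:
  assumes s: "s \<in> {0..1}" and ts: "\<And>k. t \<in> cantor (Suc k) \<longleftrightarrow> s \<in> cantor k"
  shows "on_levels c t = on_levels (\<lambda>k. c (Suc k)) s"
proof (cases "\<forall>k. s \<in> cantor k")
  case True
  then have "t \<in> cantor k" for k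
    using ts cantor_Suc_subset by blast
  with True show ?thesis unfolding on_levels_def by simp
next
  case False
  then obtain j where "s \<notin> cantor j" by auto
  note l = level_mem[OF s this]
  show ?thesis using on_levels_eq[OF l] on_levels_eq[of t "Suc (level s)" c] l ts by simp
qed

lemma on_levels_left:
  "t \<in> {0..1/4} \<Longrightarrow> on_levels c t = on_levels (\<lambda>k. c (Suc k)) (4 * t)"
  by (intro on_levels_shift cantor_Suc_left) auto

lemma on_levels_right:
  "t \<in> {3/4..1} \<Longrightarrow> on_levels c t = on_levels (\<lambda>k. c (Suc k)) (4 * t - 3)"
  by (intro on_levels_shift cantor_Suc_right) auto

lemma on_levels_middle: "t \<in> {1/4<..<3/4} \<Longrightarrow> on_levels c t = c 0"
  by (rule on_levels_eq) (auto simp: cantor.simps)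

lemma on_levels_reflect: "on_levels c (1 - t) = on_levels c t"
  unfolding on_levels_def level_def by (simp add: cantor_reflect)

lemma cantor_density_left:
  "t \<in> {0..1/4} \<Longrightarrow> cantor_density (Suc k) t = 2 * cantor_density k (4 * t)"
  unfolding cantor_density_def by (simp add: cantor_Suc_left indicator_def)

lemma cantor_density_right:
  "t \<in> {3/4..1} \<Longrightarrow> cantor_density (Suc k) t = 2 * cantor_density k (4 * t - 3)"
  unfolding cantor_density_def by (simp add: cantor_Suc_right indicator_def)

lemma cantor_density_reflect: "cantor_density k (1 - t) = cantor_density k t"
  unfolding cantor_density_def by (simp add: cantor_reflect indicator_def)

lemma cantor_density_nonneg: "0 \<le> cantor_density k t"
  unfolding cantor_density_def by simp

lemma cantor_density_integrable: "set_integrable lborel {u..v} (cantor_density k)"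
  unfolding set_integrable_def cantor_density_def real_scaleR_def
proof (rule Bochner_Integration.integrable_bound)
  show "integrable lborel (\<lambda>t. 2 ^ k * indicat_real {u..v} t)"
    by (intro integrable_mult_right integrable_real_indicator) (auto simp: emeasure_lborel_Icc_eq)
qed (auto simp: indicator_def)

lemma cantor_density_Suc_integral:
  "(LINT t:{0..1/4}|lborel. cantor_density (Suc k) t) = (LINT t:{0..1}|lborel. cantor_density k t) / 2"
  "(LINT t:{3/4..1}|lborel. cantor_density (Suc k) t) = (LINT t:{0..1}|lborel. cantor_density k t) / 2"
  using set_integral_rescale[of 0 "1/4" "cantor_density (Suc k)" 2 "cantor_density k" 0]
    set_integral_rescale[of "3/4" 1 "cantor_density (Suc k)" 2 "cantor_density k" "-3"]
  by (auto simp: cantor_density_left cantor_density_right)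

lemma cantor_density_mass: "(LINT t:{0..1}|lborel. cantor_density k t) = 1"
proof (induction k)
  case 0
  show ?case by (simp add: cantor_density_def set_lebesgue_integral_def flip: indicator_inter_arith)
next
  case (Suc k)
  have eq: "indicat_real {0..1} t *\<^sub>R cantor_density (Suc k) t
    = indicat_real {0..1/4} t *\<^sub>R cantor_density (Suc k) t + indicat_real {3/4..1} t *\<^sub>R cantor_density (Suc k) t" for t
    using cantor_subset_unit[of k] unfolding cantor_density_def
    by (auto simp: cantor.simps(2) indicator_def subset_eq dest!: spec[of _ "4 * t"] spec[of _ "4 * t - 3"])
  have "(LINT t:{0..1}|lborel. cantor_density (Suc k) t)
    = (LINT t:{0..1/4}|lborel. cantor_density (Suc k) t) + (LINT t:{3/4..1}|lborel. cantor_density (Suc k) t)"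
    using cantor_density_integrable[of _ _ "Suc k"]
    unfolding set_lebesgue_integral_def set_integrable_def eq by (subst Bochner_Integration.integral_add) auto
  then show ?case using Suc by (simp add: cantor_density_Suc_integral)
qed

lemma emeasure_cantor: "emeasure lborel (cantor k) = ennreal (1 / 2 ^ k)"
proof -
  have "(LINT t:{0..1}|lborel. cantor_density k t) = 2 ^ k * (\<integral>t. indicator (cantor k) t \<partial>lborel)"
    using cantor_subset_unit[of k] unfolding set_lebesgue_integral_def cantor_density_def
    by (subst Bochner_Integration.integral_mult_right_zero[symmetric], intro Bochner_Integration.integral_cong)
      (auto simp: indicator_def)
  then have m: "measure lborel (cantor k) = 1 / 2 ^ k"
    using cantor_density_mass[of k] by (simp add: field_simps)
  have "emeasure lborel (cantor k) \<le> emeasure lborel {0..1::real}"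
    using cantor_subset_unit by (intro emeasure_mono) auto
  then have "emeasure lborel (cantor k) \<noteq> \<infinity>" by (auto simp: top_unique)
  then show ?thesis using m by (metis emeasure_eq_ennreal_measure infinity_ennreal_def)
qed

lemma AE_not_cantor: "AE t in lborel. \<exists>k. t \<notin> cantor k"
proof -
  have le: "emeasure lborel (\<Inter>k. cantor k) \<le> ennreal (1 / 2 ^ k)" for k
    unfolding emeasure_cantor[symmetric] by (intro emeasure_mono) auto
  have "(\<lambda>k. ennreal ((1 / 2) ^ k)) \<longlonglongrightarrow> ennreal 0"
    by (intro tendsto_ennrealI LIMSEQ_power_zero) auto
  then have "emeasure lborel (\<Inter>k. cantor k) \<le> ennreal 0"
    using le by (intro LIMSEQ_le_const) (auto simp: power_one_over)
  then show ?thesis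
    by (intro AE_I[of _ _ "\<Inter>k. cantor k"]) auto
qed

text \<open>
  The points of level \<open>k\<close> lie in the \<open>k\<close>-th approximation, of length \<open>2^-k\<close>.
\<close>

lemma on_levels_integral:
  assumes c: "\<And>k. 0 \<le> c k" and sum: "summable (\<lambda>k. c k / 2 ^ k)"
  shows "set_integrable lborel {0..1} (on_levels c)"
    and "(LINT t:{0..1}|lborel. on_levels c t) \<le> (\<Sum>k. c k / 2 ^ k)"
proof -
  have nonneg: "0 \<le> indicator {0..1} t * on_levels c t" for t
    using c by (simp add: on_levels_def)
  have "(\<integral>\<^sup>+t. ennreal (indicator {0..1} t * on_levels c t) \<partial>lborel)
      \<le> (\<integral>\<^sup>+t. (\<Sum>k. ennreal (c k) * indicator (cantor k) t) \<partial>lborel)"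
  proof (rule nn_integral_mono)
    fix t
    show "ennreal (indicator {0..1} t * on_levels c t) \<le> (\<Sum>k. ennreal (c k) * indicator (cantor k) t)"
    proof (cases "t \<in> {0..1} \<and> (\<exists>k. t \<notin> cantor k)")
      case True
      then have "t \<in> cantor (level t)" using level_mem by blast
      then have "ennreal (indicator {0..1} t * on_levels c t)
          = (\<Sum>k\<in>{level t}. ennreal (c k) * indicator (cantor k) t)"
        using True by (auto simp: on_levels_def)
      also have "\<dots> \<le> (\<Sum>k. ennreal (c k) * indicator (cantor k) t)"
        by (intro sum_le_suminf) auto
      finally show ?thesis .
    qed (auto simp: on_levels_def)
  qed
  also have "\<dots> = (\<Sum>k. ennreal (c k) * ennreal (1 / 2 ^ k))"
    by (simp add: nn_integral_suminf nn_integral_cmult emeasure_cantor)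
  also have "\<dots> = (\<Sum>k. ennreal (c k / 2 ^ k))"
    using c by (simp add: ennreal_mult[symmetric])
  also have "\<dots> = ennreal (\<Sum>k. c k / 2 ^ k)"
    using c sum by (intro suminf_ennreal2) auto
  finally have le: "(\<integral>\<^sup>+t. ennreal (indicator {0..1} t * on_levels c t) \<partial>lborel) \<le> ennreal (\<Sum>k. c k / 2 ^ k)" .
  then have int: "integrable lborel (\<lambda>t. indicator {0..1} t * on_levels c t)"
    using nonneg by (intro integrableI_nonneg) (auto intro: le_less_trans)
  then show "set_integrable lborel {0..1} (on_levels c)"
    unfolding set_integrable_def by simp
  have "ennreal (\<integral>t. indicator {0..1} t * on_levels c t \<partial>lborel) \<le> ennreal (\<Sum>k. c k / 2 ^ k)"
    using le nn_integral_eq_integral[OF int] nonneg by simp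
  then show "(LINT t:{0..1}|lborel. on_levels c t) \<le> (\<Sum>k. c k / 2 ^ k)"
    using c sum by (auto simp: set_lebesgue_integral_def suminf_nonneg)
qed

section \<open>The oscillation of the roots of the Cantor step function\<close>

text \<open>
  The \<open>q\<close>-th root of the step function with the value \<open>2^k\<close> on the gaps of step \<open>k\<close>.
  As \<open>q > 1\<close>, it is integrable, whereas the step function is not.
\<close>

abbreviation root_peak :: "real \<Rightarrow> real \<Rightarrow> real" where
  "root_peak q \<equiv> on_levels (\<lambda>k. 2 powr (real k / q))"

text \<open>
  The integral on the left bounds the oscillation up to a factor of two. Dividing both sides by
  \<open>(v - u)^(q - 1)\<close> gives the bound of \<open>|I| osc(I)^q\<close> by the Cantor measure of
  \<open>I = [u,v]\<close>. The measure enters through its approximations; only large \<open>N\<close> can resolve the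
  interval, and how large depends on the interval. The constant \<open>c\<close> that is subtracted depends on
  the interval as well and scales with it, and so it is a parameter.
\<close>

definition controlled :: "real \<Rightarrow> real \<Rightarrow> real \<Rightarrow> real \<Rightarrow> real \<Rightarrow> bool" where
  "controlled q D c u v \<longleftrightarrow> (\<forall>\<^sub>F N in sequentially.
     (LINT t:{u..v}|lborel. \<bar>root_peak q t - c\<bar>) powr q
       \<le> D * (v - u) powr (q - 1) * (LINT t:{u..v}|lborel. cantor_density N t))"

lemma root_peak_integrable:
  assumes "1 < q" "0 \<le> u" "v \<le> 1"
  shows "set_integrable lborel {u..v} (root_peak q)"
proof -
  have *: "2 powr (real k / q) / 2 ^ k = (2 powr (1 / q - 1)) ^ k" for k
    by (simp add: powr_realpow[symmetric] powr_powr powr_diff[symmetric] left_diff_distrib)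
  have "1 / q - 1 < 0" using assms by (simp add: field_simps)
  then have "2 powr (1 / q - 1) < (1::real)" by (intro powr_less_one) auto
  then have "summable (\<lambda>k. 2 powr (real k / q) / 2 ^ k)"
    unfolding * by (intro summable_geometric) auto
  then have "set_integrable lborel {0..1} (root_peak q)"
    by (intro on_levels_integral) auto
  then show ?thesis
    by (rule set_integrable_subset) (use assms in auto)
qed

lemma root_peak_nonneg: "0 \<le> root_peak q t"
  by (simp add: on_levels_def)

lemma root_peak_left: "t \<in> {0..1/4} \<Longrightarrow> root_peak q t = 2 powr (1 / q) * root_peak q (4 * t)"
  and root_peak_right: "t \<in> {3/4..1} \<Longrightarrow> root_peak q t = 2 powr (1 / q) * root_peak q (4 * t - 3)"
proof -
  have "on_levels (\<lambda>k. 2 powr (real (Suc k) / q)) s = 2 powr (1 / q) * root_peak q s" for s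
    by (simp add: on_levels_def powr_add[symmetric] add_divide_distrib)
  then show "t \<in> {0..1/4} \<Longrightarrow> root_peak q t = 2 powr (1 / q) * root_peak q (4 * t)"
    and "t \<in> {3/4..1} \<Longrightarrow> root_peak q t = 2 powr (1 / q) * root_peak q (4 * t - 3)"
    by (simp_all add: on_levels_left on_levels_right del: of_nat_Suc)
qed

text \<open>
  Shrinking by the factor \<open>4\<close> multiplies the root by \<open>2^(1/q)\<close>, lengths by
  \<open>1/4\<close> and the measure by \<open>1/2\<close>. Then both sides of the bound are multiplied by
  \<open>2 / 4^q\<close>, which is why \<open>D\<close> does not change. This balance rests on \<open>2^k\<close> being the
  reciprocal of the length of the \<open>k\<close>-th approximation.
\<close>

lemma controlled_rescale:
  assumes "1 < q" "u \<le> v"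
    and c: "controlled q D c (4 * u + b) (4 * v + b)"
    and h: "\<And>t. t \<in> {u..v} \<Longrightarrow> root_peak q t = 2 powr (1 / q) * root_peak q (4 * t + b)"
    and m: "\<And>N t. t \<in> {u..v} \<Longrightarrow> cantor_density (Suc N) t = 2 * cantor_density N (4 * t + b)"
  shows "controlled q D (2 powr (1 / q) * c) u v"
proof -
  define J where "J = (LINT t:{4 * u + b..4 * v + b}|lborel. \<bar>root_peak q t - c\<bar>)"
  define M where "M N = (LINT t:{4 * u + b..4 * v + b}|lborel. cantor_density N t)" for N
  have J0: "0 \<le> J" unfolding J_def by (intro set_integral_nonneg) auto
  have "\<bar>root_peak q t - 2 powr (1 / q) * c\<bar> = 2 powr (1 / q) * \<bar>root_peak q (4 * t + b) - c\<bar>"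
    if "t \<in> {u..v}" for t
    unfolding h[OF that] right_diff_distrib[symmetric] abs_mult by simp
  then have J: "(LINT t:{u..v}|lborel. \<bar>root_peak q t - 2 powr (1 / q) * c\<bar>) = 2 powr (1 / q) / 4 * J"
    unfolding J_def by (rule set_integral_rescale[where \<psi> = "\<lambda>t. \<bar>root_peak q t - c\<bar>" and b = b])
  have M: "(LINT t:{u..v}|lborel. cantor_density (Suc N) t) = M N / 2" for N
    using set_integral_rescale[of u v "cantor_density (Suc N)" 2 "cantor_density N" b] m unfolding M_def by simp
  have p: "(2 powr (1 / q) / 4) powr q = 2 / 4 powr q" "(4::real) powr q = 4 * 4 powr (q - 1)"
    using assms by (simp_all add: powr_divide powr_powr powr_diff)
  have "\<forall>\<^sub>F N in sequentially. J powr q \<le> D * (4 * v - 4 * u) powr (q - 1) * M N"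
    using c unfolding controlled_def J_def M_def by simp
  then have "\<forall>\<^sub>F N in sequentially.
      (2 powr (1 / q) / 4 * J) powr q \<le> D * (v - u) powr (q - 1) * (M N / 2)"
  proof eventually_elim
    case (elim N)
    have "(4 * v - 4 * u) powr (q - 1) = 4 powr (q - 1) * (v - u) powr (q - 1)"
      using assms by (simp add: powr_mult[symmetric] right_diff_distrib)
    with elim have "2 / 4 powr q * J powr q
        \<le> 2 / 4 powr q * (D * (4 powr (q - 1) * (v - u) powr (q - 1)) * M N)"
      by (intro mult_left_mono) auto
    also have "\<dots> = D * (v - u) powr (q - 1) * (M N / 2)"
      unfolding p by (simp add: field_simps)
    finally show ?case by (simp only: powr_mult[of _ J] p(1))
  qed
  then have "\<forall>\<^sub>F N in sequentially. (LINT t:{u..v}|lborel. \<bar>root_peak q t - 2 powr (1 / q) * c\<bar>) powr q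
       \<le> D * (v - u) powr (q - 1) * (LINT t:{u..v}|lborel. cantor_density (Suc N) t)"
    unfolding J M .
  then show ?thesis
    unfolding controlled_def by (subst eventually_sequentially_Suc[symmetric])
qed

lemma controlled_left:
  assumes "1 < q" "0 \<le> u" "u \<le> v" "v \<le> 1/4" "controlled q D c (4 * u) (4 * v)"
  shows "controlled q D (2 powr (1 / q) * c) u v"
proof (rule controlled_rescale[where b = 0])
  fix t N assume t: "t \<in> {u..v}"
  show "root_peak q t = 2 powr (1 / q) * root_peak q (4 * t + 0)"
    using root_peak_left[of t q] t assms by simp
  show "cantor_density (Suc N) t = 2 * cantor_density N (4 * t + 0)"
    using cantor_density_left[of t N] t assms by simp
qed (use assms in auto)

lemma controlled_right:
  assumes "1 < q" "3/4 \<le> u" "u \<le> v" "v \<le> 1" "controlled q D c (4 * u - 3) (4 * v - 3)"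
  shows "controlled q D (2 powr (1 / q) * c) u v"
proof (rule controlled_rescale[where b = "-3"])
  fix t N assume t: "t \<in> {u..v}"
  show "root_peak q t = 2 powr (1 / q) * root_peak q (4 * t + -3)"
    using root_peak_right[of t q] t assms by simp
  show "cantor_density (Suc N) t = 2 * cantor_density N (4 * t + -3)"
    using cantor_density_right[of t N] t assms by simp
qed (use assms in auto)

lemma controlled_reflect:
  assumes "controlled q D c u v" shows "controlled q D c (1 - v) (1 - u)"
proof -
  have "1 - u - (1 - v) = v - u" by simp
  then show ?thesis
    using assms unfolding controlled_def set_integral_reflect on_levels_reflect cantor_density_reflect
    by (simp only:)
qed

text \<open>
  The constant with which the bound holds for the intervals \<open>[0,v]\<close>, \<open>v > 1/4\<close>: these
  have measure at least \<open>1/2\<close> and length at least \<open>1/4\<close>.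
\<close>

definition end_const :: "real \<Rightarrow> real" where
  "end_const q = 2 * 4 powr (q - 1) * (LINT t:{0..1}|lborel. root_peak q t) powr q"

text \<open>
  An interval \<open>[0,v]\<close> with \<open>v \<le> 1/4\<close> is enlarged until \<open>v > 1/4\<close>. It then contains
  all of the left child, which carries half of the measure, and the integral of the root over it is
  at most that over \<open>[0,1]\<close>. No constant is subtracted here.
\<close>

lemma controlled_initial:
  assumes q: "1 < q" and v: "0 \<le> v" "v \<le> 1"
  shows "controlled q (end_const q) 0 0 v"
proof (cases "v = 0")
  case True
  have "AE t in lborel. indicat_real {0..0} t *\<^sub>R \<phi> t = 0" for \<phi> :: "real \<Rightarrow> real"
    using AE_lborel_singleton[of 0] by eventually_elim auto
  then have "(LINT t:{0..0}|lborel. \<phi> t) = 0" for \<phi> :: "real \<Rightarrow> real"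
    unfolding set_lebesgue_integral_def by (intro integral_eq_zero_AE)
  with True show ?thesis unfolding controlled_def by simp
next
  case False
  have *: "controlled q (end_const q) 0 0 v" if "(1/4) ^ n < v" "v \<le> 1" for n v
    using that
  proof (induction n arbitrary: v)
    case (Suc n)
    show ?case
    proof (cases "v \<le> 1/4")
      case True
      have "0 < (1/4 :: real) ^ Suc n" by simp
      then have "0 < v" using Suc.prems by linarith
      then show ?thesis
        using controlled_left[of q 0 v "end_const q" 0] Suc.IH[of "4 * v"] Suc.prems True q by simp
    next
      case False
      define A where "A = (LINT t:{0..1}|lborel. root_peak q t)"
      have "(LINT t:{0..v}|lborel. \<bar>root_peak q t - 0\<bar>) \<le> A"
        unfolding A_def using set_integral_mono_superset[OF root_peak_integrable, of q 0 1 "{0..v}"] Suc.prems q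
        by (simp add: root_peak_nonneg)
      then have A: "(LINT t:{0..v}|lborel. \<bar>root_peak q t - 0\<bar>) powr q \<le> A powr q"
        using q by (intro powr_mono2) (auto intro!: set_integral_nonneg)
      have "\<forall>\<^sub>F N in sequentially. 1 \<le> N" by (rule eventually_ge_at_top)
      then show ?thesis unfolding controlled_def
      proof eventually_elim
        case (elim N)
        then obtain N' where N: "N = Suc N'" by (cases N) auto
        have "1/2 = (LINT t:{0..1/4}|lborel. cantor_density N t)"
          unfolding N cantor_density_Suc_integral cantor_density_mass ..
        also have "\<dots> \<le> (LINT t:{0..v}|lborel. cantor_density N t)"
          using False by (intro set_integral_mono_superset cantor_density_integrable cantor_density_nonneg) auto
        finally have M: "1/2 \<le> (LINT t:{0..v}|lborel. cantor_density N t)" .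
        have "(1/4) powr (q - 1) \<le> (v - 0) powr (q - 1)"
          using False q by (intro powr_mono2) auto
        with M have "(1/4) powr (q - 1) * (1/2) \<le> (v - 0) powr (q - 1) * (LINT t:{0..v}|lborel. cantor_density N t)"
          by (intro mult_mono) auto
        then have "end_const q * ((1/4) powr (q - 1) * (1/2))
           \<le> end_const q * ((v - 0) powr (q - 1) * (LINT t:{0..v}|lborel. cantor_density N t))"
          by (intro mult_left_mono) (auto simp: end_const_def)
        moreover have "end_const q * ((1/4) powr (q - 1) * (1/2)) = A powr q"
          by (simp add: end_const_def A_def powr_divide)
        ultimately show ?case using A by (simp add: mult.assoc)
      qed
    qed
  qed auto
  obtain n where "(1/4) ^ n < v"
    using real_arch_pow_inv[of v "1/4"] False v by auto
  then show ?thesis using * v by blast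
qed

lemma controlled_final:
  assumes "1 < q" "0 \<le> u" "u \<le> 1"
  shows "controlled q (end_const q) 0 u 1"
  using controlled_reflect[OF controlled_initial[of q "1 - u"]] assms by simp

text \<open>
  The root is \<open>1\<close> on the middle gap, so with \<open>c = 1\<close> only the two outer pieces count.
  They are a final interval of the left child and an initial interval of the right child, or
  degenerate when the interval ends inside the gap. Neither is longer than \<open>[u,v]\<close>, and
  \<open>q > 1\<close> allows the larger length in the bound.
\<close>

lemma controlled_crossing:
  assumes q: "1 < q" and uv: "0 \<le> u" "u < v" "v \<le> 1" and cross: "u < 3/4" "1/4 < v"
  shows "controlled q (2 powr q * end_const q) 1 u v"
proof -
  \<comment> \<open>If \<open>u > 1/4\<close>, the left piece degenerates to the single point \<open>1/4\<close>; similarly on the right.\<close>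
  define u' where "u' = min u (1/4)"
  define v' where "v' = max v (3/4)"
  have u': "0 \<le> u'" "u' \<le> 1/4" and v': "3/4 \<le> v'" "v' \<le> 1"
    using uv by (auto simp: u'_def v'_def)
  define a where "a = (LINT t:{u'..1/4}|lborel. root_peak q t)"
  define b where "b = (LINT t:{3/4..v'}|lborel. root_peak q t)"
  have ab: "0 \<le> a" "0 \<le> b"
    unfolding a_def b_def by (intro set_integral_nonneg root_peak_nonneg)+
  have i: "set_integrable lborel {u'..1/4} (root_peak q)" "set_integrable lborel {3/4..v'} (root_peak q)"
    using u' v' q by (auto intro: root_peak_integrable)
  have "(LINT t:{u..v}|lborel. \<bar>root_peak q t - 1\<bar>) \<le>
     (\<integral>t. indicator {u'..1/4} t *\<^sub>R root_peak q t + indicator {3/4..v'} t *\<^sub>R root_peak q t \<partial>lborel)"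
    unfolding set_lebesgue_integral_def
  proof (rule integral_mono_AE)
    have "set_integrable lborel {u..v} (\<lambda>t. root_peak q t - 1)"
      using uv q by (intro set_integral_diff root_peak_integrable) (auto simp: set_integrable_def)
    from set_integrable_abs[OF this]
    show "integrable lborel (\<lambda>t. indicator {u..v} t *\<^sub>R \<bar>root_peak q t - 1\<bar>)"
      by (simp only: set_integrable_def)
    show "integrable lborel (\<lambda>t. indicator {u'..1/4} t *\<^sub>R root_peak q t + indicator {3/4..v'} t *\<^sub>R root_peak q t)"
      using i unfolding set_integrable_def by (rule Bochner_Integration.integrable_add)
    show "AE t in lborel. indicator {u..v} t *\<^sub>R \<bar>root_peak q t - 1\<bar>
       \<le> indicator {u'..1/4} t *\<^sub>R root_peak q t + indicator {3/4..v'} t *\<^sub>R root_peak q t"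
      using AE_not_cantor
    proof eventually_elim
      case (elim t)
      then have "1 \<le> root_peak q t"
        using q by (auto simp: on_levels_def intro!: ge_one_powr_ge_zero)
      moreover have "root_peak q t = 1" if "1/4 < t" "t < 3/4"
        using on_levels_middle[of t] that by auto
      ultimately show ?case
        using uv by (auto simp: indicator_def u'_def v'_def)
    qed
  qed
  also have "\<dots> = a + b"
    using i unfolding a_def b_def set_lebesgue_integral_def set_integrable_def
    by (rule Bochner_Integration.integral_add)
  finally have J: "(LINT t:{u..v}|lborel. \<bar>root_peak q t - 1\<bar>) \<le> a + b" .
  have M: "(LINT t:{u'..1/4}|lborel. cantor_density N t) + (LINT t:{3/4..v'}|lborel. cantor_density N t)
     \<le> (LINT t:{u..v}|lborel. cantor_density N t)" for N
  proof -
    note i = cantor_density_integrable[of _ _ N, unfolded set_integrable_def]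
    have "(LINT t:{u'..1/4}|lborel. cantor_density N t) + (LINT t:{3/4..v'}|lborel. cantor_density N t)
       = (\<integral>t. indicator {u'..1/4} t *\<^sub>R cantor_density N t + indicator {3/4..v'} t *\<^sub>R cantor_density N t \<partial>lborel)"
      unfolding set_lebesgue_integral_def by (rule Bochner_Integration.integral_add[OF i i, symmetric])
    also have "\<dots> \<le> (LINT t:{u..v}|lborel. cantor_density N t)"
      unfolding set_lebesgue_integral_def
    proof (rule integral_mono_AE[OF Bochner_Integration.integrable_add[OF i i] i])
      show "AE t in lborel. indicator {u'..1/4} t *\<^sub>R cantor_density N t + indicator {3/4..v'} t *\<^sub>R cantor_density N t
        \<le> indicator {u..v} t *\<^sub>R cantor_density N t"
        using AE_lborel_singleton[of "1/4"] AE_lborel_singleton[of "3/4"]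
        by eventually_elim (use cross cantor_density_nonneg in \<open>auto simp: indicator_def u'_def v'_def min_def max_def split: if_splits\<close>)
    qed
    finally show ?thesis .
  qed
  have c: "controlled q (end_const q) 0 u' (1/4)" "controlled q (end_const q) 0 (3/4) v'"
    using controlled_left[of q u' "1/4" "end_const q" 0] controlled_final[of q "4 * u'"]
      controlled_right[of q "3/4" v' "end_const q" 0] controlled_initial[of q "4 * v' - 3"] u' v' q
    by auto
  have E: "0 \<le> end_const q" by (simp add: end_const_def)
  have m0: "0 \<le> (LINT t:S|lborel. cantor_density N t)" for S N
    by (intro set_integral_nonneg cantor_density_nonneg)
  from c have "\<forall>\<^sub>F N in sequentially.
      a powr q \<le> end_const q * (1/4 - u') powr (q - 1) * (LINT t:{u'..1/4}|lborel. cantor_density N t) \<and>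
      b powr q \<le> end_const q * (v' - 3/4) powr (q - 1) * (LINT t:{3/4..v'}|lborel. cantor_density N t)"
    unfolding controlled_def a_def b_def by (simp add: root_peak_nonneg eventually_conj_iff)
  then show ?thesis
    unfolding controlled_def
  proof eventually_elim
    case (elim N)
    have "(1/4 - u') powr (q - 1) \<le> (v - u) powr (q - 1)" "(v' - 3/4) powr (q - 1) \<le> (v - u) powr (q - 1)"
      using q uv cross by (auto intro!: powr_mono2 simp: u'_def v'_def)
    then have "end_const q * (1/4 - u') powr (q - 1) * (LINT t:{u'..1/4}|lborel. cantor_density N t)
         \<le> end_const q * (v - u) powr (q - 1) * (LINT t:{u'..1/4}|lborel. cantor_density N t)"
       "end_const q * (v' - 3/4) powr (q - 1) * (LINT t:{3/4..v'}|lborel. cantor_density N t)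
         \<le> end_const q * (v - u) powr (q - 1) * (LINT t:{3/4..v'}|lborel. cantor_density N t)"
      using E m0 by (auto intro!: mult_right_mono mult_left_mono)
    with elim have s: "a powr q + b powr q \<le> end_const q * (v - u) powr (q - 1) *
       ((LINT t:{u'..1/4}|lborel. cantor_density N t) + (LINT t:{3/4..v'}|lborel. cantor_density N t))"
      unfolding distrib_left by linarith
    have "(LINT t:{u..v}|lborel. \<bar>root_peak q t - 1\<bar>) powr q \<le> (a + b) powr q"
      using J q by (intro powr_mono2) (auto intro!: set_integral_nonneg)
    also have "\<dots> \<le> 2 powr q * (a powr q + b powr q)"
      using ab q by (intro powr_add_le) auto
    also have "\<dots> \<le> 2 powr q * (end_const q * (v - u) powr (q - 1) * (LINT t:{u..v}|lborel. cantor_density N t))"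
      using s M[of N] E by (intro mult_left_mono order.trans[OF s]) auto
    finally show ?case by (simp add: mult.assoc)
  qed
qed

text \<open>
  An interval contained in a child is enlarged by the similarity of that child. As its length grows
  by a factor of four each time, it must eventually cross the middle gap.
\<close>

lemma controlled_interval:
  assumes q: "1 < q" and uv: "0 \<le> u" "u < v" "v \<le> 1"
  shows "\<exists>c. controlled q (2 powr q * end_const q) c u v"
proof -
  have *: "\<exists>c. controlled q (2 powr q * end_const q) c u v"
    if "(1/4) ^ n < v - u" "0 \<le> u" "v \<le> 1" for n u v
    using that
  proof (induction n arbitrary: u v)
    case (Suc n)
    have "0 < (1/4 :: real) ^ Suc n" by simp
    then have "u < v" using Suc.prems by linarith
    consider "v \<le> 1/4" | "3/4 \<le> u" | "u < 3/4" "1/4 < v" by linarith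
    then show ?case
    proof cases
      case 1
      then obtain c where "controlled q (2 powr q * end_const q) c (4 * u) (4 * v)"
        using Suc.IH[of "4 * v" "4 * u"] Suc.prems by auto
      then show ?thesis using controlled_left[of q u v] 1 q Suc.prems \<open>u < v\<close> by auto
    next
      case 2
      then obtain c where "controlled q (2 powr q * end_const q) c (4 * u - 3) (4 * v - 3)"
        using Suc.IH[of "4 * v - 3" "4 * u - 3"] Suc.prems by auto
      then show ?thesis using controlled_right[of q u v] 2 q Suc.prems \<open>u < v\<close> by auto
    next
      case 3
      then show ?thesis using controlled_crossing[of q u v] q Suc.prems \<open>u < v\<close> by auto
    qed
  qed auto
  obtain n where "(1/4) ^ n < v - u"
    using real_arch_pow_inv[of "v - u" "1/4"] uv by auto
  then show ?thesis using * uv by blast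
qed

section \<open>The rippled profile\<close>

text \<open>
  The exponent \<open>\<epsilon>\<close> of the ripple is switched on in the right half of each gap. The gaps of
  step \<open>k\<close> are centred at the midpoints of cells of length \<open>4^-k\<close>, so the right half is where
  the position within the cell exceeds \<open>1/2\<close>.
\<close>

definition ripple :: "real \<Rightarrow> real \<Rightarrow> real" where
  "ripple p t = real (Suc (level t)) powr (- 1 / p) * of_bool (1/2 < frac (4 ^ level t * t))"

definition profile :: "real \<Rightarrow> real \<Rightarrow> real" where
  "profile p t = on_levels (\<lambda>k. 2 ^ k) t * 2 powr ripple p t"

lemma ripple_measurable [measurable]: "ripple p \<in> borel_measurable borel"
proof -
  have [measurable]: "(\<lambda>k. real (Suc k)) \<in> count_space UNIV \<rightarrow>\<^sub>M borel"
    "(\<lambda>k. 4 ^ k :: real) \<in> count_space UNIV \<rightarrow>\<^sub>M borel" by simp_all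
  show ?thesis unfolding ripple_def[abs_def] frac_def of_bool_def by measurable
qed

lemma profile_measurable [measurable]: "profile p \<in> borel_measurable borel"
  unfolding profile_def[abs_def] by measurable

lemma profile_nonneg: "0 \<le> profile p t"
  by (simp add: profile_def on_levels_def)

lemma ripple_bounds:
  assumes "0 < p"
  shows "0 \<le> ripple p t" "ripple p t \<le> real (Suc (level t)) powr (- 1 / p)" "ripple p t \<le> 1"
proof -
  have "real (Suc (level t)) powr (- 1 / p) \<le> 1"
    using assms powr_mono[of "- 1 / p" 0 "real (Suc (level t))"] by simp
  then show "0 \<le> ripple p t" "ripple p t \<le> real (Suc (level t)) powr (- 1 / p)" "ripple p t \<le> 1"
    by (auto simp: ripple_def)
qed

lemma profile_root:
  "profile p t powr (1 / q) = root_peak q t * 2 powr (ripple p t / q)"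
  by (simp add: profile_def on_levels_def powr_mult powr_powr powr_realpow[symmetric])

lemma two_powr_le: "0 \<le> y \<Longrightarrow> y \<le> 1 \<Longrightarrow> 2 powr y \<le> 1 + (y::real)"
  using convex_onD[OF exp_convex, of y 0 "ln 2"] by (simp add: powr_def)

text \<open>
  The majorant \<open>\<epsilon> 2^(k/q)\<close> of the change that the ripple makes to the root. Its \<open>q\<close>-th
  power is integrable exactly when the sum of \<open>\<epsilon>^q = (k+1)^(-q/p)\<close> converges.
\<close>

definition ripple_bound :: "real \<Rightarrow> real \<Rightarrow> real \<Rightarrow> real" where
  "ripple_bound p q = on_levels (\<lambda>k. real (Suc k) powr (- 1 / p) * 2 powr (real k / q))"

lemma profile_root_diff:
  assumes "1 < p" "1 < q"
  shows "\<bar>profile p t powr (1 / q) - root_peak q t\<bar> \<le> ripple_bound p q t"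
proof -
  note r = ripple_bounds[of p t]
  have y: "0 \<le> ripple p t / q" "ripple p t / q \<le> ripple p t"
    using r assms mult_left_mono[of 1 q "ripple p t"] by (auto simp: field_simps)
  then have "2 powr (ripple p t / q) - 1 \<le> real (Suc (level t)) powr (- 1 / p)" "0 \<le> 2 powr (ripple p t / q) - 1"
    using two_powr_le[of "ripple p t / q"] r assms by (auto intro: ge_one_powr_ge_zero)
  then have "root_peak q t * (2 powr (ripple p t / q) - 1) \<le> root_peak q t * real (Suc (level t)) powr (- 1 / p)"
    "0 \<le> root_peak q t * (2 powr (ripple p t / q) - 1)"
    by (auto intro!: mult_left_mono root_peak_nonneg mult_nonneg_nonneg)
  then show ?thesis
    unfolding profile_root by (simp add: ripple_bound_def on_levels_def algebra_simps split: if_splits)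
qed

lemma ripple_bound_nonneg: "0 \<le> ripple_bound p q t"
  by (simp add: ripple_bound_def on_levels_def)

lemma ripple_bound_integrable:
  assumes "1 < p" "p < q" "0 \<le> u" "v \<le> 1"
  shows "set_integrable lborel {u..v} (\<lambda>t. ripple_bound p q t powr q)"
    and "set_integrable lborel {u..v} (ripple_bound p q)"
    and "set_integrable lborel {u..v} (\<lambda>t. profile p t powr (1 / q))"
proof -
  have q: "1 < q" using assms by simp
  have *: "(\<lambda>t. ripple_bound p q t powr q) = on_levels (\<lambda>k. real (Suc k) powr (- q / p) * 2 ^ k)"
    using q by (auto simp: ripple_bound_def on_levels_def powr_mult powr_powr powr_realpow fun_eq_iff simp del: of_nat_Suc)
  have "- q / p < -1" using assms by (simp add: field_simps)
  then have "summable (\<lambda>k. real (Suc k) powr (- q / p) * 2 ^ k / 2 ^ k)"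
    using summable_real_powr_iff[of "- q / p"] by (subst (asm) summable_Suc_iff[symmetric]) simp
  then have "set_integrable lborel {0..1} (\<lambda>t. ripple_bound p q t powr q)"
    unfolding * by (intro on_levels_integral) auto
  then show "set_integrable lborel {u..v} (\<lambda>t. ripple_bound p q t powr q)"
    by (rule set_integrable_subset) (use assms in auto)
  have h: "set_integrable lborel {u..v} (root_peak q)"
    using assms by (intro root_peak_integrable) auto
  have [measurable]: "ripple_bound p q \<in> borel_measurable borel"
    unfolding ripple_bound_def by measurable
  show rb: "set_integrable lborel {u..v} (ripple_bound p q)"
  proof (rule set_integrable_bound[OF h])
    have "real (Suc k) powr (- 1 / p) \<le> 1" for k
      using assms powr_mono[of "- 1 / p" 0 "real (Suc k)"] by simp
    then show "AE t in lborel. t \<in> {u..v} \<longrightarrow> norm (ripple_bound p q t) \<le> norm (root_peak q t)"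
      by (auto simp: ripple_bound_def on_levels_def mult_left_le_one_le)
  qed (simp add: set_borel_measurable_def)
  have "set_integrable lborel {u..v} (\<lambda>t. root_peak q t + ripple_bound p q t)"
    by (intro set_integral_add h rb)
  then show "set_integrable lborel {u..v} (\<lambda>t. profile p t powr (1 / q))"
  proof (rule set_integrable_bound)
    have "norm (profile p t powr (1 / q)) \<le> norm (root_peak q t + ripple_bound p q t)" for t
      using profile_root_diff[of p q t] assms root_peak_nonneg[of q t] ripple_bound_nonneg[of p q t] by auto
    then show "AE t in lborel. t \<in> {u..v} \<longrightarrow> norm (profile p t powr (1 / q)) \<le> norm (root_peak q t + ripple_bound p q t)"
      by auto
  qed (simp add: set_borel_measurable_def)
qed

text \<open>
  A density whose mass in an interval dominates the oscillation there: one summand for the step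
  function, one for the ripple. Its total mass does not depend on \<open>N\<close>.
\<close>

definition control_density :: "real \<Rightarrow> real \<Rightarrow> nat \<Rightarrow> real \<Rightarrow> real" where
  "control_density p q N t = 4 powr q * (2 powr q * end_const q * cantor_density N t + ripple_bound p q t powr q)"

lemma control_nonneg: "0 \<le> control_density p q N t"
  unfolding control_density_def end_const_def
  by (intro mult_nonneg_nonneg add_nonneg_nonneg cantor_density_nonneg powr_ge_zero) simp_all

lemma control_integral:
  assumes "1 < p" "p < q" "0 \<le> u" "v \<le> 1"
  shows "set_integrable lborel {u..v} (control_density p q N)"
    and "(LINT t:{u..v}|lborel. control_density p q N t) = 4 powr q * (2 powr q * end_const q *
       (LINT t:{u..v}|lborel. cantor_density N t) + (LINT t:{u..v}|lborel. ripple_bound p q t powr q))"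
proof -
  have i: "set_integrable lborel {u..v} (\<lambda>t. 2 powr q * end_const q * cantor_density N t)"
    by (intro set_integrable_mult_right cantor_density_integrable)
  note j = ripple_bound_integrable(1)[OF assms]
  show "set_integrable lborel {u..v} (control_density p q N)"
    unfolding control_density_def[abs_def] by (intro set_integrable_mult_right set_integral_add(1) i j)
  show "(LINT t:{u..v}|lborel. control_density p q N t) = 4 powr q * (2 powr q * end_const q *
       (LINT t:{u..v}|lborel. cantor_density N t) + (LINT t:{u..v}|lborel. ripple_bound p q t powr q))"
    unfolding control_density_def[abs_def] set_integral_mult_right set_integral_add(2)[OF i j] ..
qed

text \<open>
  The root of the profile is the root of the step function plus a change bounded by the ripple
  majorant. The first part is handled by the Cantor measure, the second by Jensen's inequality.
\<close>

lemma profile_oscillation_le: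
  assumes p: "1 < p" "p < q" and uv: "0 \<le> u" "u < v" "v \<le> 1"
  defines "F \<equiv> \<lambda>t. profile p t powr (1 / q)"
  shows "\<forall>\<^sub>F N in sequentially. (v - u) * ((LINT t:{u..v}|lborel.
      \<bar>F t - (LINT t:{u..v}|lborel. F t) / (v - u)\<bar>) / (v - u)) powr q
    \<le> (LINT t:{u..v}|lborel. control_density p q N t)"
proof -
  have q: "1 < q" using p by simp
  obtain c where "controlled q (2 powr q * end_const q) c u v"
    using controlled_interval[OF q uv] by blast
  then have ev: "\<forall>\<^sub>F N in sequentially. (LINT t:{u..v}|lborel. \<bar>root_peak q t - c\<bar>) powr q
       \<le> 2 powr q * end_const q * (v - u) powr (q - 1) * (LINT t:{u..v}|lborel. cantor_density N t)"
    unfolding controlled_def .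
  note rb = ripple_bound_integrable[OF p uv(1,3)]
  define J where "J = (LINT t:{u..v}|lborel. \<bar>root_peak q t - c\<bar>)"
  define R where "R = (LINT t:{u..v}|lborel. ripple_bound p q t)"
  have JR: "0 \<le> J" "0 \<le> R"
    unfolding J_def R_def by (intro set_integral_nonneg ripple_bound_nonneg; simp)+
  have const: "set_integrable lborel {u..v} (\<lambda>t. c)" for c :: real
    by (rule set_integrable_const_interval)
  have h: "set_integrable lborel {u..v} (\<lambda>t. \<bar>root_peak q t - c\<bar>)"
    using uv q by (intro set_integrable_abs set_integral_diff const root_peak_integrable) auto
  define osc where "osc = (LINT t:{u..v}|lborel. \<bar>F t - (LINT t:{u..v}|lborel. F t) / (v - u)\<bar>)"
  have "osc \<le> 2 * (LINT t:{u..v}|lborel. \<bar>F t - c\<bar>)"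
    unfolding osc_def F_def using uv rb by (intro mean_oscillation_le) auto
  also have "(LINT t:{u..v}|lborel. \<bar>F t - c\<bar>) \<le> (LINT t:{u..v}|lborel. \<bar>root_peak q t - c\<bar> + ripple_bound p q t)"
  proof (intro set_integral_mono set_integral_add h rb)
    show "set_integrable lborel {u..v} (\<lambda>t. \<bar>F t - c\<bar>)"
      unfolding F_def by (intro set_integrable_abs set_integral_diff const rb)
    show "\<bar>F t - c\<bar> \<le> \<bar>root_peak q t - c\<bar> + ripple_bound p q t" for t
      using profile_root_diff[of p q t] p q unfolding F_def by linarith
  qed
  also have "\<dots> = J + R"
    unfolding J_def R_def using h rb by (intro set_integral_add)
  finally have osc: "osc \<le> 2 * (J + R)" by simp
  have osc0: "0 \<le> osc" unfolding osc_def by (intro set_integral_nonneg) auto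
  have Rq: "(v - u) * (R / (v - u)) powr q \<le> (LINT t:{u..v}|lborel. ripple_bound p q t powr q)"
    unfolding R_def using uv q rb ripple_bound_nonneg by (intro power_mean_inequality) auto
  have "osc / (v - u) \<le> 2 * (J / (v - u) + R / (v - u))"
    using divide_right_mono[OF osc, of "v - u"] uv
    unfolding add_divide_distrib[symmetric] by (simp only: times_divide_eq_right)
  then have "(osc / (v - u)) powr q \<le> (2 * (J / (v - u) + R / (v - u))) powr q"
    using osc0 uv q by (intro powr_mono2) auto
  also have "\<dots> = 2 powr q * (J / (v - u) + R / (v - u)) powr q"
    by (simp only: powr_mult)
  also have "\<dots> \<le> 2 powr q * (2 powr q * ((J / (v - u)) powr q + (R / (v - u)) powr q))"
    using JR uv q by (intro mult_left_mono powr_add_le) auto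
  also have "\<dots> = 4 powr q * ((J / (v - u)) powr q + (R / (v - u)) powr q)"
    using powr_mult[of 2 2 q] by simp
  finally have "(v - u) * (osc / (v - u)) powr q
    \<le> (v - u) * (4 powr q * ((J / (v - u)) powr q + (R / (v - u)) powr q))"
    using uv by (intro mult_left_mono) auto
  then have main: "(v - u) * (osc / (v - u)) powr q
    \<le> 4 powr q * ((v - u) * (J / (v - u)) powr q + (v - u) * (R / (v - u)) powr q)"
    by (simp add: algebra_simps)
  have Jq: "(v - u) * (J / (v - u)) powr q = J powr q / (v - u) powr (q - 1)"
    using uv by (simp add: powr_divide powr_diff)
  from ev show ?thesis
  proof eventually_elim
    case (elim N)
    then have "J powr q / (v - u) powr (q - 1) \<le> 2 powr q * end_const q * (LINT t:{u..v}|lborel. cantor_density N t)"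
      using uv unfolding J_def by (simp add: field_simps)
    then have "4 powr q * ((v - u) * (J / (v - u)) powr q + (v - u) * (R / (v - u)) powr q)
       \<le> (LINT t:{u..v}|lborel. control_density p q N t)"
      unfolding control_integral(2)[OF p uv(1,3)] Jq using Rq
      by (intro mult_left_mono add_mono) auto
    with main show ?case unfolding osc_def by linarith
  qed
qed

section \<open>The oscillation of the profile on a gap\<close>

text \<open>
  The cells of step \<open>k\<close>, numbered by their position among the \<open>4^k\<close> intervals of length
  \<open>4^-k\<close>: the numbers whose \<open>k\<close> digits in base four are all \<open>0\<close> or \<open>3\<close>. The digit
  that is added at each step is the leading one, in accordance with the recursion for \<open>cantor\<close>.
\<close>

primrec cantor_index :: "nat \<Rightarrow> nat set" where
  "cantor_index 0 = {0}"
| "cantor_index (Suc k) = cantor_index k \<union> (\<lambda>m. m + 3 * 4 ^ k) ` cantor_index k"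

lemma cantor_index_less: "m \<in> cantor_index k \<Longrightarrow> m < 4 ^ k"
proof (induction k arbitrary: m)
  case (Suc k)
  then obtain m' where "m' \<in> cantor_index k" "m = m' \<or> m = m' + 3 * 4 ^ k" by auto
  moreover from this(1) have "m' < 4 ^ k" by (rule Suc.IH)
  ultimately show ?case unfolding power_Suc by linarith
qed simp

lemma finite_cantor_index: "finite (cantor_index k)"
  by (induction k) auto

lemma card_cantor_index: "card (cantor_index k) = 2 ^ k"
proof (induction k)
  case (Suc k)
  have "cantor_index k \<inter> (\<lambda>m. m + 3 * 4 ^ k) ` cantor_index k = {}"
  proof (rule equals0I)
    fix m assume "m \<in> cantor_index k \<inter> (\<lambda>m. m + 3 * 4 ^ k) ` cantor_index k"
    then obtain m' where "m' + 3 * 4 ^ k \<in> cantor_index k" by auto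
    then have "m' + 3 * 4 ^ k < (4 ^ k :: nat)" by (rule cantor_index_less)
    then show False by simp
  qed
  moreover have "card ((\<lambda>m. m + 3 * 4 ^ k) ` cantor_index k) = card (cantor_index k)"
    by (intro card_image) (simp add: inj_on_def)
  ultimately show ?case
    using Suc by (simp add: card_Un_disjoint finite_cantor_index)
qed simp

lemma cantor_gap:
  assumes "m \<in> cantor_index k" "4 ^ k * t - real m \<in> {1/4<..<3/4}"
  shows "t \<in> cantor k \<and> t \<notin> cantor (Suc k)"
  using assms
proof (induction k arbitrary: m t)
  case 0
  then show ?case by (auto simp: cantor.simps)
next
  case (Suc k)
  consider "m \<in> cantor_index k" | m' where "m' \<in> cantor_index k" "m = m' + 3 * 4 ^ k"
    using Suc.prems(1) by auto
  then show ?case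
  proof cases
    case 1
    then have *: "4 * t \<in> cantor k \<and> 4 * t \<notin> cantor (Suc k)"
      using Suc.prems by (intro Suc.IH[of m]) (auto simp: mult_ac)
    then have "t \<le> 1/4" using cantor_subset_unit[of k] by auto
    with * show ?thesis by (simp add: cantor_Suc_left)
  next
    case (2 m')
    then have *: "4 * t - 3 \<in> cantor k \<and> 4 * t - 3 \<notin> cantor (Suc k)"
      using Suc.prems by (intro Suc.IH[of m']) (auto simp: algebra_simps)
    then have "3/4 \<le> t" using cantor_subset_unit[of k] by auto
    with * show ?thesis by (simp add: cantor_Suc_right)
  qed
qed

text \<open>
  The two values are taken on halves of equal length, so the mean is their midpoint and the
  deviation from it is constant.
\<close>

lemma mean_oscillation_two_values:
  fixes \<phi> :: "real \<Rightarrow> real"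
  assumes uv: "u < v" and w: "w = (u + v) / 2"
    and A: "\<And>t. t \<in> {u<..<w} \<Longrightarrow> \<phi> t = A" and B: "\<And>t. t \<in> {w<..<v} \<Longrightarrow> \<phi> t = B"
    and [measurable]: "\<phi> \<in> borel_measurable borel"
  shows "(LINT t:{u..v}|lborel. \<bar>\<phi> t - (LINT t:{u..v}|lborel. \<phi> t) / (v - u)\<bar>) / (v - u) = \<bar>B - A\<bar> / 2"
proof -
  note [simp] = integrable_indicator_interval
  have "(LINT t:{u..v}|lborel. \<phi> t)
     = (\<integral>t. A * indicator {u..w} t + B * indicator {w..v} t \<partial>lborel)"
    unfolding set_lebesgue_integral_def
  proof (intro integral_cong_AE)
    show "AE t in lborel. indicator {u..v} t *\<^sub>R \<phi> t = A * indicator {u..w} t + B * indicator {w..v} t"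
      using AE_lborel_singleton[of u] AE_lborel_singleton[of v] AE_lborel_singleton[of w]
      by eventually_elim (use A B uv w in \<open>auto simp: indicator_def\<close>)
  qed auto
  also have "\<dots> = (v - u) * ((A + B) / 2)"
    using uv w by (subst Bochner_Integration.integral_add) (auto simp: field_simps)
  finally have m: "(LINT t:{u..v}|lborel. \<phi> t) / (v - u) = (A + B) / 2"
    using uv by simp
  have "(LINT t:{u..v}|lborel. \<bar>\<phi> t - (A + B) / 2\<bar>)
     = (\<integral>t. \<bar>B - A\<bar> / 2 * indicator {u..v} t \<partial>lborel)"
    unfolding set_lebesgue_integral_def
  proof (intro integral_cong_AE)
    have d: "\<bar>A - (A + B) / 2\<bar> = \<bar>B - A\<bar> / 2" "\<bar>B - (A + B) / 2\<bar> = \<bar>B - A\<bar> / 2"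
      by (auto simp: abs_if field_simps)
    show "AE t in lborel. indicator {u..v} t *\<^sub>R \<bar>\<phi> t - (A + B) / 2\<bar> = \<bar>B - A\<bar> / 2 * indicator {u..v} t"
      using AE_lborel_singleton[of u] AE_lborel_singleton[of v] AE_lborel_singleton[of w]
    proof eventually_elim
      case (elim t)
      then consider "t < u \<or> v < t" | "t \<in> {u<..<w}" | "t \<in> {w<..<v}" by fastforce
      then show ?case
        by cases (use uv w in \<open>auto simp: A B d\<close>)
    qed
  qed auto
  also have "\<dots> = (v - u) * (\<bar>B - A\<bar> / 2)"
    using uv by simp
  finally show ?thesis unfolding m using uv by simp
qed

text \<open>
  On a gap of step \<open>k\<close> the root takes the values \<open>2^(k/q)\<close> and \<open>2^((k+\<epsilon>)/q)\<close>, on halves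
  of equal length, and \<open>2^y \<ge> 1 + y ln 2\<close>.
\<close>

lemma profile_gap_oscillation:
  assumes p: "1 < p" and q: "1 < q" and m: "m \<in> cantor_index k"
  defines "u \<equiv> (real m + 1/4) / 4 ^ k" and "v \<equiv> (real m + 3/4) / 4 ^ k"
    and "F \<equiv> \<lambda>t. profile p t powr (1 / q)"
  shows "(ln 2 / (2 * q)) powr q * 2 ^ k * real (Suc k) powr (- q / p)
    \<le> ((LINT t:{u..v}|lborel. \<bar>F t - (LINT t:{u..v}|lborel. F t) / (v - u)\<bar>) / (v - u)) powr q"
proof -
  define e where "e = real (Suc k) powr (- 1 / p)"
  define A B where "A = 2 powr (real k / q)" and "B = A * 2 powr (e / q)"
  define w where "w = (real m + 1/2) / 4 ^ k"
  have gap: "root_peak q t = A" "ripple p t = e * of_bool (w < t)" if "t \<in> {u<..<v}" for t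
  proof -
    have t: "4 ^ k * t - real m \<in> {1/4<..<3/4}"
      using that unfolding u_def v_def by (simp add: field_simps)
    then have "frac (4 ^ k * t) = 4 ^ k * t - real m"
      by (subst frac_unique_iff) auto
    then have "1/2 < frac (4 ^ k * t) \<longleftrightarrow> w < t"
      unfolding w_def by (subst pos_divide_less_eq) (auto simp: mult.commute)
    moreover note c = cantor_gap[OF m t]
    moreover have "level t = k" using c by (intro level_eqI) auto
    ultimately show "root_peak q t = A" "ripple p t = e * of_bool (w < t)"
      using on_levels_eq[of t k] by (auto simp: A_def ripple_def e_def)
  qed
  have uw: "u < w" "w < v" unfolding u_def v_def w_def by (simp_all add: divide_strict_right_mono)
  have "(LINT t:{u..v}|lborel. \<bar>F t - (LINT t:{u..v}|lborel. F t) / (v - u)\<bar>) / (v - u) = \<bar>B - A\<bar> / 2" (is "?osc = _")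
  proof (rule mean_oscillation_two_values[where w = w])
    show "w = (u + v) / 2" unfolding u_def v_def w_def by (simp add: field_simps)
    show "F t = A" if "t \<in> {u<..<w}" for t
      using gap[of t] that uw by (simp add: F_def profile_root)
    show "F t = B" if "t \<in> {w<..<v}" for t
      using gap[of t] that uw by (simp add: F_def profile_root B_def)
  qed (use uw in \<open>auto simp: F_def\<close>)
  moreover have "A * (e * (ln 2 / (2 * q))) \<le> \<bar>B - A\<bar> / 2"
  proof -
    have "1 + e / q * ln 2 \<le> 2 powr (e / q)"
      using exp_ge_add_one_self[of "e / q * ln 2"] by (simp add: powr_def)
    then have "A * (e / q * ln 2) \<le> A * (2 powr (e / q) - 1)"
      by (intro mult_left_mono) (auto simp: A_def)
    then have le: "A * (e / q * ln 2) \<le> \<bar>B - A\<bar>"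
      by (simp add: B_def algebra_simps)
    have eq: "A * (e * (ln 2 / (2 * q))) = A * (e / q * ln 2) / 2"
      by simp
    show ?thesis unfolding eq by (rule divide_right_mono[OF le]) simp
  qed
  ultimately have "A * (e * (ln 2 / (2 * q))) \<le> ?osc" by (simp only:)
  then have "(A * (e * (ln 2 / (2 * q)))) powr q
    \<le> ((LINT t:{u..v}|lborel. \<bar>F t - (LINT t:{u..v}|lborel. F t) / (v - u)\<bar>) / (v - u)) powr q"
    using q by (intro powr_mono2) (auto simp: A_def e_def)
  moreover have "(A * (e * (ln 2 / (2 * q)))) powr q = A powr q * (e powr q * (ln 2 / (2 * q)) powr q)"
    by (simp only: powr_mult)
  moreover have "A powr q = 2 ^ k" "e powr q = real (Suc k) powr (- q / p)"
    using q by (simp_all add: A_def e_def powr_powr powr_realpow del: of_nat_Suc)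
  ultimately show ?thesis by (simp add: mult_ac)
qed

section \<open>Cubes and functions of one coordinate\<close>

text \<open>
  Which of its faces belong to a cube is irrelevant for integration. All that is kept of a cube is
  its corner \<open>a\<close> and its edge length \<open>l\<close>, between the open and the closed box.
\<close>

definition cube_between :: "real ^ 'n \<Rightarrow> real \<Rightarrow> (real ^ 'n) set \<Rightarrow> bool" where
  "cube_between a l Q \<longleftrightarrow> 0 < l \<and> box a (a + vec l) \<subseteq> Q \<and> Q \<subseteq> cbox a (a + vec l)"

lemma is_cube_between:
  fixes Q :: "(real ^ 'n) set"
  assumes "is_cube Q" obtains a l where "cube_between a l Q"
proof -
  from assms obtain a :: "real ^ 'n" and l I where "0 < l"
    and I: "\<And>i. {a $ i <..< a $ i + l} \<subseteq> I i" "\<And>i. I i \<subseteq> {a $ i .. a $ i + l}"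
    and Q: "Q = {x. \<forall>i. x $ i \<in> I i}"
    unfolding is_cube_def by blast
  have "x \<in> Q" if "x \<in> box a (a + vec l)" for x
    using that I(1) unfolding Q by (fastforce simp: mem_box_cart)
  moreover have "x \<in> cbox a (a + vec l)" if "x \<in> Q" for x
    using that I(2) unfolding Q by (fastforce simp: mem_box_cart)
  ultimately have "cube_between a l Q"
    using \<open>0 < l\<close> unfolding cube_between_def by blast
  then show thesis by (rule that)
qed

lemma is_cube_box: "0 < l \<Longrightarrow> is_cube (box a (a + vec l))"
  unfolding is_cube_def
  by (rule exI[of _ a], rule exI[of _ l], rule exI[of _ "\<lambda>i. {a $ i <..< a $ i + l}"])
    (auto simp: mem_box_cart)

text \<open>
  The closed box is the closure of the open one, so inclusions between cubes pass to the closed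
  boxes and their corners can be compared.
\<close>

lemma cube_between_mono:
  assumes "cube_between a l Q" "cube_between a' l' Q'" "Q' \<subseteq> Q"
  shows "a $ i \<le> a' $ i" "a' $ i + l' \<le> a $ i + l"
proof -
  have "box a' (a' + vec l') \<subseteq> cbox a (a + vec l)"
    using assms unfolding cube_between_def by blast
  moreover have "box a' (a' + vec l') \<noteq> {}"
    using assms(2) unfolding cube_between_def by (simp add: interval_ne_empty_cart)
  ultimately have "closure (box a' (a' + vec l')) \<subseteq> cbox a (a + vec l)"
    by (intro closure_minimal) auto
  then have "cbox a' (a' + vec l') \<subseteq> cbox a (a + vec l)"
    using \<open>box a' (a' + vec l') \<noteq> {}\<close> by (simp add: closure_box)
  moreover have "a' \<in> cbox a' (a' + vec l')" "a' + vec l' \<in> cbox a' (a' + vec l')"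
    using assms(2) by (auto simp: cube_between_def mem_box_cart)
  ultimately have "a' \<in> cbox a (a + vec l)" "a' + vec l' \<in> cbox a (a + vec l)"
    by blast+
  then show "a $ i \<le> a' $ i" "a' $ i + l' \<le> a $ i + l"
    by (simp_all add: mem_box_cart)
qed

lemma cube_AE_cbox:
  assumes "cube_between a l Q"
  shows "Q \<in> sets lebesgue" "AE x in lebesgue. x \<in> Q \<longleftrightarrow> x \<in> cbox a (a + vec l)"
proof -
  let ?N = "cbox a (a + vec l) - box a (a + vec l)"
  have N: "negligible ?N" by (rule negligible_frontier_interval)
  have Q: "Q = box a (a + vec l) \<union> (Q \<inter> ?N)" "Q \<subseteq> cbox a (a + vec l)"
    using assms unfolding cube_between_def by blast+
  have "Q \<inter> ?N \<in> sets lebesgue"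
    using negligible_subset[OF N, of "Q \<inter> ?N"] by (blast intro: negligible_imp_sets)
  then show "Q \<in> sets lebesgue" by (subst Q(1)) auto
  have "AE x in lebesgue. x \<notin> ?N"
    using N by (intro AE_not_in) (simp add: negligible_iff_null_sets)
  then show "AE x in lebesgue. x \<in> Q \<longleftrightarrow> x \<in> cbox a (a + vec l)"
    by eventually_elim (use Q in blast)
qed

lemma measure_cube:
  fixes Q :: "(real ^ 'n) set"
  assumes Q: "cube_between a l Q"
  shows "emeasure lebesgue Q = ennreal (l ^ CARD('n))" "measure lebesgue Q = l ^ CARD('n)"
proof -
  have "0 < l" using Q by (simp add: cube_between_def)
  have "emeasure lebesgue Q = emeasure lebesgue (cbox a (a + vec l))"
    using cube_AE_cbox[OF Q] by (intro emeasure_eq_AE) auto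
  also have "\<dots> = ennreal (measure lborel (cbox a (a + vec l)))"
    using emeasure_lborel_cbox_finite[of a "a + vec l"] by (simp add: emeasure_eq_ennreal_measure less_top)
  also have "measure lborel (cbox a (a + vec l)) = l ^ CARD('n)"
    using \<open>0 < l\<close> by (subst content_cbox_cart) (auto simp: interval_ne_empty_cart)
  finally show "emeasure lebesgue Q = ennreal (l ^ CARD('n))" .
  then show "measure lebesgue Q = l ^ CARD('n)"
    using \<open>0 < l\<close> by (simp add: measure_def)
qed

text \<open>
  Up to null sets, the part of a cube beyond a hyperplane \<open>x $ i = t\<close> is again a box, with
  one edge cut off at \<open>t\<close>.
\<close>

lemma cube_halfspace:
  fixes Q :: "(real ^ 'n) set"
  assumes Q: "cube_between a l Q"
  shows "emeasure lebesgue (Q \<inter> {x. t < x $ i})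
    = ennreal (l ^ (CARD('n) - 1)) * emeasure lborel ({a $ i..a $ i + l} \<inter> {t<..})"
proof -
  have l: "0 < l" using Q by (simp add: cube_between_def)
  define s where "s = max (a $ i) t"
  define a' where "a' = (\<chi> j. if j = i then s else a $ j)"
  have eq: "cbox a' (a + vec l) = cbox a (a + vec l) \<inter> {x. t \<le> x $ i}"
    by (auto simp: mem_box_cart a'_def s_def split: if_splits)
  \<comment> \<open>Needed because the half-space is open and the box is closed.\<close>
  have hyper: "AE x::real^'n in lebesgue. x $ i \<noteq> t"
  proof -
    have "negligible {x::real^'n. x \<bullet> axis i 1 = t}"
      by (rule negligible_standard_hyperplane) (simp add: axis_in_Basis_iff)
    then have "AE x::real^'n in lebesgue. x \<notin> {x. x \<bullet> axis i 1 = t}"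
      by (intro AE_not_in) (simp add: negligible_iff_null_sets)
    then show ?thesis by eventually_elim (simp add: inner_axis)
  qed
  have "{x :: real ^ 'n. t < x $ i} \<in> sets borel"
    by (intro borel_open open_halfspace_component_gt_cart)
  then have half: "{x :: real ^ 'n. t < x $ i} \<in> sets lebesgue" by simp
  have "emeasure lebesgue (Q \<inter> {x. t < x $ i}) = emeasure lebesgue (cbox a' (a + vec l))"
  proof (rule emeasure_eq_AE)
    show "AE x in lebesgue. x \<in> Q \<inter> {x. t < x $ i} \<longleftrightarrow> x \<in> cbox a' (a + vec l)"
      using cube_AE_cbox(2)[OF Q] hyper unfolding eq by eventually_elim auto
  qed (use cube_AE_cbox(1)[OF Q] half in auto)
  also have "\<dots> = ennreal (measure lborel (cbox a' (a + vec l)))"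
    using emeasure_lborel_cbox_finite[of a' "a + vec l"] by (simp add: emeasure_eq_ennreal_measure less_top)
  finally have 1: "emeasure lebesgue (Q \<inter> {x. t < x $ i}) = ennreal (measure lborel (cbox a' (a + vec l)))" .
  have 2: "emeasure lborel ({a $ i..a $ i + l} \<inter> {t<..}) = emeasure lborel {s..a $ i + l}"
  proof (rule emeasure_eq_AE)
    show "AE x in lborel. x \<in> {a $ i..a $ i + l} \<inter> {t<..} \<longleftrightarrow> x \<in> {s..a $ i + l}"
      using AE_lborel_singleton[of t] by eventually_elim (auto simp: s_def)
  qed auto
  show ?thesis
  proof (cases "s \<le> a $ i + l")
    case True
    then have "measure lborel (cbox a' (a + vec l)) = (\<Prod>j\<in>UNIV. (a + vec l) $ j - a' $ j)"
      using l by (intro content_cbox_cart) (auto simp: interval_ne_empty_cart a'_def)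
    also have "\<dots> = (a $ i + l - s) * (\<Prod>j\<in>UNIV - {i}. (a + vec l) $ j - a' $ j)"
      by (subst prod.remove[of _ i]) (auto simp: a'_def)
    also have "(\<Prod>j\<in>UNIV - {i}. (a + vec l) $ j - a' $ j) = (\<Prod>j\<in>UNIV - {i}. l)"
      by (intro prod.cong) (auto simp: a'_def)
    also have "\<dots> = l ^ (CARD('n) - 1)" by (simp add: card_Diff_singleton)
    finally show ?thesis
      unfolding 1 2 using True l by (simp add: emeasure_lborel_Icc_eq ennreal_mult[symmetric] mult.commute)
  next
    case False
    have "x \<notin> cbox a' (a + vec l)" for x
    proof
      assume "x \<in> cbox a' (a + vec l)"
      then have "a' $ i \<le> x $ i" "x $ i \<le> (a + vec l) $ i"
        unfolding mem_box_cart by blast+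
      with False show False by (simp add: a'_def)
    qed
    then have "cbox a' (a + vec l) = {}" by blast
    with False show ?thesis unfolding 1 2 by (simp add: emeasure_lborel_Icc_eq)
  qed
qed

lemma coordinate_measurable: "(\<lambda>x::real^'n. x $ i) \<in> borel_measurable (lebesgue_on Q)"
proof (rule measurable_restrict_space1)
  have "continuous_on UNIV (\<lambda>x::real^'n. x $ i)" by (intro continuous_intros)
  then show "(\<lambda>x::real^'n. x $ i) \<in> borel_measurable lebesgue"
    by (intro measurable_completion) (simp add: borel_measurable_continuous_onI)
qed

lemma cube_coordinate_distribution:
  fixes Q :: "(real ^ 'n) set"
  assumes Q: "cube_between a l Q"
  shows "distr (lebesgue_on Q) borel (\<lambda>x. x $ i)
    = density lborel (\<lambda>t. ennreal (l ^ (CARD('n) - 1) * indicator {a $ i..a $ i + l} t))"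
proof (rule measure_eqI_lessThan)
  have l: "0 < l" using Q by (simp add: cube_between_def)
  note m = coordinate_measurable[of i Q]
  have *: "emeasure (distr (lebesgue_on Q) borel (\<lambda>x. x $ i)) {t<..} = emeasure lebesgue (Q \<inter> {x. t < x $ i})" for t
    using cube_AE_cbox(1)[OF Q] m
    by (subst emeasure_distr) (auto simp: emeasure_restrict_space space_restrict_space vimage_def Int_commute)
  show "emeasure (distr (lebesgue_on Q) borel (\<lambda>x. x $ i)) {t<..} < \<infinity>" for t
  proof -
    have "emeasure lebesgue (Q \<inter> {x. t < x $ i}) \<le> emeasure lebesgue Q"
      using cube_AE_cbox(1)[OF Q] by (intro emeasure_mono) auto
    also have "\<dots> < \<infinity>" unfolding measure_cube(1)[OF Q] by simp
    finally show ?thesis unfolding * .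
  qed
  show "emeasure (distr (lebesgue_on Q) borel (\<lambda>x. x $ i)) {t<..}
    = emeasure (density lborel (\<lambda>t. ennreal (l ^ (CARD('n) - 1) * indicator {a $ i..a $ i + l} t))) {t<..}" for t
  proof -
    have "emeasure (density lborel (\<lambda>t. ennreal (l ^ (CARD('n) - 1) * indicator {a $ i..a $ i + l} t))) {t<..}
       = (\<integral>\<^sup>+s. ennreal (l ^ (CARD('n) - 1)) * indicator ({a $ i..a $ i + l} \<inter> {t<..}) s \<partial>lborel)"
      by (subst emeasure_density) (auto intro!: nn_integral_cong simp: indicator_def)
    then show ?thesis
      unfolding * cube_halfspace[OF Q] by (simp add: nn_integral_cmult)
  qed
qed auto

text \<open>
  Under the coordinate map the volume on a cube becomes length on its edge, times the volume of a
  face. The affine change of variable moves the edge of a reference cube to \<open>[0,1]\<close>.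
\<close>

lemma coordinate_set_integral:
  fixes Q :: "(real ^ 'n) set" and \<phi> :: "real \<Rightarrow> real" and r s :: real and i :: 'n
  assumes Q: "cube_between a l Q" and [measurable]: "\<phi> \<in> borel_measurable borel" and "0 < r"
  defines "u \<equiv> (a $ i - s) / r" and "v \<equiv> (a $ i + l - s) / r"
  shows "(LINT x:Q|lebesgue. \<phi> ((x $ i - s) / r)) = r * l ^ (CARD('n) - 1) * (LINT t:{u..v}|lborel. \<phi> t)"
    and "set_integrable lborel {u..v} \<phi> \<Longrightarrow> set_integrable lebesgue Q (\<lambda>x. \<phi> ((x $ i - s) / r))"
proof -
  have l: "0 < l" using Q by (simp add: cube_between_def)
  define \<psi> where "\<psi> t = \<phi> ((t - s) / r)" for t
  have [measurable]: "\<psi> \<in> borel_measurable borel" unfolding \<psi>_def by measurable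
  note m = coordinate_measurable[of i Q]
  have Qm: "Q \<inter> space lebesgue \<in> sets lebesgue" using cube_AE_cbox(1)[OF Q] by simp
  have aff: "(LINT t:{u..v}|lborel. \<phi> t) = (LINT t:{a $ i..a $ i + l}|lborel. \<psi> t) / r"
    using set_integral_affine[OF \<open>0 < r\<close>, of u v \<psi> s] \<open>0 < r\<close>
    unfolding \<psi>_def u_def v_def by (simp add: add.commute)
  have "(LINT x:Q|lebesgue. \<psi> (x $ i)) = integral\<^sup>L (lebesgue_on Q) (\<lambda>x. \<psi> (x $ i))"
    unfolding set_lebesgue_integral_def using Qm by (rule integral_restrict_space[symmetric])
  also have "\<dots> = integral\<^sup>L (distr (lebesgue_on Q) borel (\<lambda>x. x $ i)) \<psi>"
    using m by (intro integral_distr[symmetric]) auto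
  also have "\<dots> = (\<integral>t. (l ^ (CARD('n) - 1) * indicator {a $ i..a $ i + l} t) *\<^sub>R \<psi> t \<partial>lborel)"
    unfolding cube_coordinate_distribution[OF Q] using l by (intro integral_density) auto
  also have "\<dots> = l ^ (CARD('n) - 1) * (LINT t:{a $ i..a $ i + l}|lborel. \<psi> t)"
    unfolding set_lebesgue_integral_def by (simp add: mult.assoc)
  finally show "(LINT x:Q|lebesgue. \<phi> ((x $ i - s) / r)) = r * l ^ (CARD('n) - 1) * (LINT t:{u..v}|lborel. \<phi> t)"
    unfolding aff \<psi>_def using \<open>0 < r\<close> by simp
  assume "set_integrable lborel {u..v} \<phi>"
  then have "integrable lborel (\<lambda>t. indicator {u..v} t *\<^sub>R \<phi> t)"
    by (simp add: set_integrable_def)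
  from lborel_integrable_real_affine[OF this, of "1 / r" "- s / r"]
  have "integrable lborel (\<lambda>t. indicator {u..v} ((t - s) / r) *\<^sub>R \<psi> t)"
    using \<open>0 < r\<close> by (simp add: \<psi>_def diff_divide_distrib)
  moreover have "indicator {u..v} ((t - s) / r) = indicat_real {a $ i..a $ i + l} t" for t
    using \<open>0 < r\<close> unfolding u_def v_def by (auto simp: indicator_def divide_le_cancel)
  ultimately have "integrable lborel (\<lambda>t. l ^ (CARD('n) - 1) * (indicator {a $ i..a $ i + l} t *\<^sub>R \<psi> t))"
    by (intro integrable_mult_right) simp
  then have "integrable (distr (lebesgue_on Q) borel (\<lambda>x. x $ i)) \<psi>"
    unfolding cube_coordinate_distribution[OF Q] using l by (subst integrable_density) (auto simp: mult.assoc)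
  then have "integrable (lebesgue_on Q) (\<lambda>x. \<psi> (x $ i))"
    using m by (subst (asm) integrable_distr_eq) auto
  then show "set_integrable lebesgue Q (\<lambda>x. \<phi> ((x $ i - s) / r))"
    unfolding \<psi>_def set_integrable_def using Qm by (subst (asm) integrable_restrict_space) auto
qed

lemma cube_volume_split:
  assumes "cube_between (a :: real ^ 'n) l Q" "0 < r"
  shows "measure lebesgue Q = r * l ^ (CARD('n) - 1) * ((a $ i + l - s) / r - (a $ i - s) / r)"
proof -
  have "l ^ CARD('n) = l * l ^ (CARD('n) - 1)"
    by (metis One_nat_def Suc_pred power_Suc zero_less_card_finite)
  then show ?thesis unfolding measure_cube(2)[OF assms(1)] using assms(2) by (simp add: field_simps)
qed

lemma mean_oscillation_coordinate:
  fixes Q :: "(real ^ 'n) set" and \<phi> :: "real \<Rightarrow> real" and r s :: real and i :: 'n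
  assumes Q: "cube_between a l Q" and \<phi>: "\<phi> \<in> borel_measurable borel" and r: "0 < r"
  defines "u \<equiv> (a $ i - s) / r" and "v \<equiv> (a $ i + l - s) / r"
  shows "mean Q (\<lambda>x. \<bar>\<phi> ((x $ i - s) / r) - mean Q (\<lambda>x. \<phi> ((x $ i - s) / r))\<bar>)
      = (LINT t:{u..v}|lborel. \<bar>\<phi> t - (LINT t:{u..v}|lborel. \<phi> t) / (v - u)\<bar>) / (v - u)"
proof -
  have l: "0 < l" using Q by (simp add: cube_between_def)
  have *: "mean Q (\<lambda>x. \<psi> ((x $ i - s) / r)) = (LINT t:{u..v}|lborel. \<psi> t) / (v - u)"
    if "\<psi> \<in> borel_measurable borel" for \<psi> :: "real \<Rightarrow> real"
    unfolding mean_def coordinate_set_integral(1)[OF Q that r] cube_volume_split[OF Q r, of i s] u_def v_def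
    using r l by simp
  note [measurable] = \<phi>
  show "mean Q (\<lambda>x. \<bar>\<phi> ((x $ i - s) / r) - mean Q (\<lambda>x. \<phi> ((x $ i - s) / r))\<bar>)
      = (LINT t:{u..v}|lborel. \<bar>\<phi> t - (LINT t:{u..v}|lborel. \<phi> t) / (v - u)\<bar>) / (v - u)"
    unfolding *[OF \<phi>] by (rule *) measurable
qed

section \<open>Exponents above the threshold\<close>

text \<open>
  For finitely many disjoint cubes a common \<open>N\<close> can be chosen for which each term of the sum is
  at most the mass that the control density, as a function of the \<open>i\<close>-th coordinate, has in the
  cube. Disjointness bounds the sum of these masses by the mass in the whole cube, which is finite and
  does not depend on \<open>N\<close>.
\<close>

lemma coordinate_profile_in_JN:
  fixes Q\<^sub>0 :: "(real ^ 'n) set" and i :: 'n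
  assumes Q0: "cube_between a l Q\<^sub>0" and p: "1 < p" "p < q"
  shows "(\<lambda>x. profile p ((x $ i - a $ i) / l) powr (1 / q)) \<in> JN q Q\<^sub>0"
proof -
  have l: "0 < l" using Q0 by (simp add: cube_between_def)
  define F where "F t = profile p t powr (1 / q)" for t
  define h where "h x = F ((x $ i - a $ i) / l)" for x :: "real ^ 'n"
  define W where "W N x = control_density p q N ((x $ i - a $ i) / l)" for N and x :: "real ^ 'n"
  have [measurable]: "F \<in> borel_measurable borel" unfolding F_def by measurable
  have ripple_meas: "ripple_bound p q \<in> borel_measurable borel" unfolding ripple_bound_def by measurable
  have control_meas: "control_density p q N \<in> borel_measurable borel" for N
    using ripple_meas unfolding control_density_def[abs_def] by measurable
  have unit: "(a $ i - a $ i) / l = 0" "(a $ i + l - a $ i) / l = 1" using l by simp_all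
  have h_int: "set_integrable lebesgue Q\<^sub>0 h"
    unfolding h_def using ripple_bound_integrable(3)[OF p, of 0 1]
    by (intro coordinate_set_integral(2)[OF Q0 _ l]) (simp_all add: unit F_def)
  have W_int: "set_integrable lebesgue Q\<^sub>0 (W N)" for N
    unfolding W_def using control_integral(1)[OF p, of 0 1]
    by (intro coordinate_set_integral(2)[OF Q0 control_meas l]) (simp_all add: unit)
  have W_nonneg: "0 \<le> W N x" for N x
    unfolding W_def by (rule control_nonneg)
  define B where "B = l * l ^ (CARD('n) - 1) * (4 powr q * (2 powr q * end_const q + (LINT t:{0..1}|lborel. ripple_bound p q t powr q)))"
  have W_total: "(LINT x:Q\<^sub>0|lebesgue. W N x) = B" for N
    unfolding W_def coordinate_set_integral(1)[OF Q0 control_meas l] unit B_def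
    using control_integral(2)[OF p, of 0 1 N] by (simp add: cantor_density_mass)
  have "0 \<le> B"
    unfolding W_total[of 0, symmetric] by (intro set_integral_nonneg W_nonneg)
  define osc where "osc Q = measure lebesgue Q * (mean Q (\<lambda>x. \<bar>h x - mean Q h\<bar>)) powr q" for Q
  have osc_le: "\<forall>\<^sub>F N in sequentially. osc Q \<le> (LINT x:Q|lebesgue. W N x)"
    if Q: "is_cube Q" "Q \<subseteq> Q\<^sub>0" for Q
  proof -
    obtain b k where b: "cube_between b k Q" using is_cube_between[OF Q(1)] .
    have k: "0 < k" using b by (simp add: cube_between_def)
    define u v where "u = (b $ i - a $ i) / l" and "v = (b $ i + k - a $ i) / l"
    have uv: "0 \<le> u" "u < v" "v \<le> 1"
      using cube_between_mono[OF Q0 b Q(2), of i] k l unfolding u_def v_def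
      by (simp_all add: divide_strict_right_mono)
    have mQ: "mean Q (\<lambda>x. \<bar>h x - mean Q h\<bar>)
       = (LINT t:{u..v}|lborel. \<bar>F t - (LINT t:{u..v}|lborel. F t) / (v - u)\<bar>) / (v - u)"
      unfolding h_def u_def v_def by (rule mean_oscillation_coordinate[OF b _ l]) measurable
    have volQ: "measure lebesgue Q = l * k ^ (CARD('n) - 1) * (v - u)"
      unfolding u_def v_def by (rule cube_volume_split[OF b l])
    have intQ: "(LINT x:Q|lebesgue. W N x) = l * k ^ (CARD('n) - 1) * (LINT t:{u..v}|lborel. control_density p q N t)" for N
      unfolding W_def u_def v_def by (rule coordinate_set_integral(1)[OF b control_meas l])
    from profile_oscillation_le[OF p uv, folded F_def]
    show ?thesis
    proof eventually_elim
      case (elim N)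
      then show ?case
        unfolding osc_def mQ volQ intQ mult.assoc[of "l * k ^ (CARD('n) - 1)"]
        using l k by (intro mult_left_mono) auto
    qed
  qed
  have sum_le: "(\<Sum>Q\<in>\<F>. osc Q) \<le> B"
    if \<F>: "finite \<F>" "pairwise disjnt \<F>" "\<And>Q. Q \<in> \<F> \<Longrightarrow> is_cube Q \<and> Q \<subseteq> Q\<^sub>0" for \<F>
  proof -
    have "\<forall>\<^sub>F N in sequentially. \<forall>Q\<in>\<F>. osc Q \<le> (LINT x:Q|lebesgue. W N x)"
      using \<F> osc_le by (intro eventually_ball_finite) auto
    then obtain N where N: "\<And>Q. Q \<in> \<F> \<Longrightarrow> osc Q \<le> (LINT x:Q|lebesgue. W N x)"
      by (auto simp: eventually_sequentially)
    have meas: "Q \<in> sets lebesgue" if "Q \<in> \<F>" for Q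
      using \<F>(3)[OF that] by (metis is_cube_between cube_AE_cbox(1))
    have int: "set_integrable lebesgue Q (W N)" if "Q \<in> \<F>" for Q
      using that \<F>(3) meas by (intro set_integrable_subset[OF W_int]) auto
    have "(\<Sum>Q\<in>\<F>. osc Q) \<le> (\<Sum>Q\<in>\<F>. LINT x:Q|lebesgue. W N x)"
      by (intro sum_mono N)
    also have "\<dots> = (LINT x:(\<Union>Q\<in>\<F>. Q)|lebesgue. W N x)"
      using \<F> meas int
      by (intro set_integral_finite_Union[symmetric])
        (auto simp: disjoint_family_on_def pairwise_def disjnt_def)
    also have "\<dots> \<le> (LINT x:Q\<^sub>0|lebesgue. W N x)"
    proof -
      have "(\<Union>Q\<in>\<F>. Q) \<in> sets lebesgue" using \<F>(1) meas by auto
      then have "set_integrable lebesgue (\<Union>Q\<in>\<F>. Q) (W N)"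
        using \<F>(3) by (intro set_integrable_subset[OF W_int]) auto
      then show ?thesis
        using W_int[of N] \<F>(3) W_nonneg unfolding set_lebesgue_integral_def set_integrable_def
        by (intro integral_mono) (auto simp: indicator_def)
    qed
    finally show ?thesis unfolding W_total .
  qed
  \<comment> \<open>\<open>B^(1/q)\<close> is the constant in the definition of \<open>JN q\<close>.\<close>
  have "(\<Sum>\<^sub>\<infinity>Q\<in>\<C>. ennreal (osc Q)) \<le> ennreal ((B powr (1 / q)) powr q)"
    if \<C>: "pairwise disjnt \<C>" "\<forall>Q\<in>\<C>. is_cube Q \<and> Q \<subseteq> Q\<^sub>0" for \<C>
  proof (rule infsum_le_finite_sums)
    show "(\<lambda>Q. ennreal (osc Q)) summable_on \<C>" by (rule nonneg_summable_on_complete) simp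
    fix \<F> assume F: "finite \<F>" "\<F> \<subseteq> \<C>"
    have "(\<Sum>Q\<in>\<F>. ennreal (osc Q)) = ennreal (\<Sum>Q\<in>\<F>. osc Q)"
      by (intro sum_ennreal) (simp add: osc_def)
    also have "\<dots> \<le> ennreal B"
      using F \<C> by (intro ennreal_leI sum_le) (auto intro: pairwise_subset)
    also have "B = (B powr (1 / q)) powr q"
      using p \<open>0 \<le> B\<close> by (simp add: powr_powr)
    finally show "(\<Sum>Q\<in>\<F>. ennreal (osc Q)) \<le> ennreal ((B powr (1 / q)) powr q)" .
  qed
  then have "h \<in> JN q Q\<^sub>0"
    unfolding JN_def osc_def using h_int by (auto intro!: exI[of _ "B powr (1 / q)"])
  then show ?thesis unfolding h_def F_def .
qed

section \<open>Exponents up to the threshold\<close>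

text \<open>
  The cube number \<open>(k, m)\<close> is centred in the cell number \<open>m\<close> of the grid of mesh
  \<open>l / 4^k\<close>, with half of its edge length. When the \<open>i\<close>-th entry of \<open>m\<close> numbers a cell
  of step \<open>k\<close>, its \<open>i\<close>-th edge is a gap.
\<close>

definition gap_cube :: "real ^ 'n \<Rightarrow> real \<Rightarrow> nat \<times> ('n \<Rightarrow> nat) \<Rightarrow> (real ^ 'n) set" where
  "gap_cube a l = (\<lambda>(k, m). box (\<chi> j. a $ j + l * ((real (m j) + 1/4) / 4 ^ k))
     ((\<chi> j. a $ j + l * ((real (m j) + 1/4) / 4 ^ k)) + vec (l / (2 * 4 ^ k))))"

definition gap_index :: "'n \<Rightarrow> nat \<Rightarrow> ('n \<Rightarrow> nat) set" where
  "gap_index i k = (\<Pi>\<^sub>E j\<in>UNIV. if j = i then cantor_index k else {..<4 ^ k})"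

lemma card_gap_index: "card (gap_index (i :: 'n :: finite) k) = 2 ^ k * (4 ^ k) ^ (CARD('n) - 1)"
proof -
  have "card (gap_index i k) = (\<Prod>j\<in>UNIV. card (if j = i then cantor_index k else {..<4 ^ k}))"
    unfolding gap_index_def by (intro card_PiE) simp
  also have "\<dots> = card (cantor_index k) * (\<Prod>j\<in>UNIV - {i}. card (if j = i then cantor_index k else {..<4 ^ k}))"
    by (subst prod.remove[of _ i]) auto
  also have "(\<Prod>j\<in>UNIV - {i}. card (if j = i then cantor_index k else {..<4 ^ k})) = (\<Prod>j\<in>UNIV - {i}. 4 ^ k)"
    by (intro prod.cong) auto
  finally show ?thesis by (simp add: card_cantor_index card_Diff_singleton)
qed

lemma finite_gap_index: "finite (gap_index (i :: 'n :: finite) k)"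
  unfolding gap_index_def by (intro finite_PiE) (auto simp: finite_cantor_index)

lemma gap_index_D:
  assumes "m \<in> gap_index i k"
  shows "m i \<in> cantor_index k" "m j < 4 ^ k"
proof -
  have *: "m j \<in> (if j = i then cantor_index k else {..<4 ^ k})" for j
    using assms unfolding gap_index_def by (rule PiE_mem) simp
  from *[of i] show "m i \<in> cantor_index k" by simp
  from *[of j] show "m j < 4 ^ k" by (auto split: if_splits dest: cantor_index_less)
qed

lemma mem_gap_cube:
  assumes "0 < l"
  shows "x \<in> gap_cube a l (k, m) \<longleftrightarrow> (\<forall>j. 4 ^ k * ((x $ j - a $ j) / l) - real (m j) \<in> {1/4<..<3/4})"
proof -
  have "a $ j + l * ((real (m j) + 1/4) / 4 ^ k) < x $ j \<longleftrightarrow> 1/4 < 4 ^ k * ((x $ j - a $ j) / l) - real (m j)" for j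
    using assms by (simp add: field_simps)
  moreover have "x $ j < a $ j + l * ((real (m j) + 1/4) / 4 ^ k) + l / (2 * 4 ^ k)
      \<longleftrightarrow> 4 ^ k * ((x $ j - a $ j) / l) - real (m j) < 3/4" for j
    using assms by (simp add: field_simps)
  ultimately show ?thesis
    unfolding gap_cube_def by (simp add: mem_box_cart)
qed

text \<open>
  A common point has a level, which is determined by its \<open>i\<close>-th coordinate; so the steps agree,
  and in the grid of that step the cubes lie in different cells unless they are equal.
\<close>

lemma gap_cubes_disjoint:
  assumes l: "0 < l" and m: "m \<in> gap_index i k" "m' \<in> gap_index i k'"
    and x: "x \<in> gap_cube a l (k, m)" "x \<in> gap_cube a l (k', m')"
  shows "k = k' \<and> m = m'"
proof -
  define t where "t j = (x $ j - a $ j) / l" for j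
  have t: "4 ^ k * t j - real (m j) \<in> {1/4<..<3/4}" "4 ^ k' * t j - real (m' j) \<in> {1/4<..<3/4}" for j
    using x l unfolding t_def by (simp_all add: mem_gap_cube)
  have "level (t i) = k" "level (t i) = k'"
    using cantor_gap[OF gap_index_D(1)[OF m(1)] t(1)] cantor_gap[OF gap_index_D(1)[OF m(2)] t(2)]
    by (blast intro: level_eqI)+
  then have "k = k'" by simp
  moreover have "m j = m' j" for j
    using t[of j] unfolding \<open>k = k'\<close> by auto
  ultimately show ?thesis by auto
qed

lemma gap_cube_between:
  fixes Q\<^sub>0 :: "(real ^ 'n) set"
  assumes Q0: "cube_between a l Q\<^sub>0" and m: "m \<in> gap_index i k"
  defines "b \<equiv> (\<chi> j. a $ j + l * ((real (m j) + 1/4) / 4 ^ k))"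
  shows "cube_between b (l / (2 * 4 ^ k)) (gap_cube a l (k, m))" "is_cube (gap_cube a l (k, m))"
    "gap_cube a l (k, m) \<subseteq> Q\<^sub>0" "gap_cube a l (k, m) \<noteq> {}"
proof -
  have l: "0 < l" using Q0 by (simp add: cube_between_def)
  have eq: "gap_cube a l (k, m) = box b (b + vec (l / (2 * 4 ^ k)))"
    unfolding gap_cube_def b_def by simp
  show "cube_between b (l / (2 * 4 ^ k)) (gap_cube a l (k, m))"
    unfolding eq cube_between_def using l by (auto simp: box_subset_cbox)
  show "is_cube (gap_cube a l (k, m))"
    unfolding eq using l by (intro is_cube_box) simp
  show "gap_cube a l (k, m) \<noteq> {}"
    unfolding eq using l by (simp add: interval_ne_empty_cart)
  have "x \<in> box a (a + vec l)" if "x \<in> gap_cube a l (k, m)" for x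
    unfolding mem_box_cart
  proof
    fix j
    define t where "t = (x $ j - a $ j) / l"
    have t: "1/4 < 4 ^ k * t - real (m j)" "4 ^ k * t - real (m j) < 3/4"
      using that l unfolding t_def by (simp_all add: mem_gap_cube)
    have "m j + 1 \<le> 4 ^ k" using gap_index_D(2)[OF m, of j] by simp
    then have "real (m j) + 1 \<le> 4 ^ k"
      using of_nat_le_iff[of "m j + 1" "4 ^ k", where ?'a = real] by simp
    with t have "4 ^ k * 0 < 4 ^ k * t" "4 ^ k * t < 4 ^ k * 1" by linarith+
    then have "0 < t" "t < 1" by (simp_all only: mult_less_cancel_left_pos zero_less_power zero_less_numeral)
    then show "a $ j < x $ j \<and> x $ j < (a + vec l) $ j"
      unfolding t_def using l by (simp add: field_simps)
  qed
  then show "gap_cube a l (k, m) \<subseteq> Q\<^sub>0"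
    using Q0 unfolding cube_between_def by blast
qed

text \<open>
  There are \<open>2^k 4^(k(n-1))\<close> cubes of step \<open>k\<close>, each of volume \<open>(l / (2 4^k))^n\<close>, and on
  each of them the \<open>q\<close>-th power of the oscillation is at least a constant times
  \<open>2^k (k+1)^(-q/p)\<close>. The powers of two cancel, and the sum over the first \<open>N\<close> steps is a
  multiple of a partial sum of the series of the \<open>(k+1)^(-q/p)\<close>, which diverges for
  \<open>q \<le> p\<close>.
\<close>

lemma coordinate_profile_notin_JN:
  fixes Q\<^sub>0 :: "(real ^ 'n) set" and i :: 'n
  assumes Q0: "cube_between a l Q\<^sub>0" and p: "1 < p" and q: "1 < q" "q \<le> p"
  shows "(\<lambda>x. profile p ((x $ i - a $ i) / l) powr (1 / q)) \<notin> JN q Q\<^sub>0"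
proof
  have l: "0 < l" using Q0 by (simp add: cube_between_def)
  define F where "F t = profile p t powr (1 / q)" for t
  define h where "h x = F ((x $ i - a $ i) / l)" for x :: "real ^ 'n"
  have [measurable]: "F \<in> borel_measurable borel" unfolding F_def by measurable
  define osc where "osc Q = measure lebesgue Q * (mean Q (\<lambda>x. \<bar>h x - mean Q h\<bar>)) powr q" for Q
  assume "(\<lambda>x. profile p ((x $ i - a $ i) / l) powr (1 / q)) \<in> JN q Q\<^sub>0"
  then have "h \<in> JN q Q\<^sub>0" unfolding h_def F_def .
  then obtain K where K: "\<And>\<C>. countable \<C> \<Longrightarrow> pairwise disjnt \<C> \<Longrightarrow> \<forall>Q\<in>\<C>. is_cube Q \<and> Q \<subseteq> Q\<^sub>0 \<Longrightarrow>
        (\<Sum>\<^sub>\<infinity>Q\<in>\<C>. ennreal (osc Q)) \<le> ennreal (K powr q)"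
    unfolding JN_def osc_def by auto
  define c where "c = (l / 2) ^ CARD('n) * (ln 2 / (2 * q)) powr q"
  have "0 < c" unfolding c_def using l q by simp
  have osc_ge: "(l / (2 * 4 ^ k)) ^ CARD('n) * ((ln 2 / (2 * q)) powr q * 2 ^ k * real (Suc k) powr (- q / p))
       \<le> osc (gap_cube a l (k, m))" if m: "m \<in> gap_index i k" for k m
  proof -
    note b = gap_cube_between(1)[OF Q0 m]
    have u: "(a $ i + l * ((real (m i) + 1/4) / 4 ^ k) - a $ i) / l = (real (m i) + 1/4) / 4 ^ k"
      using l by simp
    have v: "(a $ i + l * ((real (m i) + 1/4) / 4 ^ k) + l / (2 * 4 ^ k) - a $ i) / l = (real (m i) + 3/4) / 4 ^ k"
      using l by (simp add: field_simps)
    have "mean (gap_cube a l (k, m)) (\<lambda>x. \<bar>h x - mean (gap_cube a l (k, m)) h\<bar>) =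
       (LINT t:{(real (m i) + 1/4) / 4 ^ k..(real (m i) + 3/4) / 4 ^ k}|lborel.
          \<bar>F t - (LINT t:{(real (m i) + 1/4) / 4 ^ k..(real (m i) + 3/4) / 4 ^ k}|lborel. F t)
            / ((real (m i) + 3/4) / 4 ^ k - (real (m i) + 1/4) / 4 ^ k)\<bar>)
         / ((real (m i) + 3/4) / 4 ^ k - (real (m i) + 1/4) / 4 ^ k)"
      using mean_oscillation_coordinate[OF b _ l, of F i "a $ i"] unfolding h_def vec_lambda_beta u v by simp
    then show ?thesis
      unfolding osc_def measure_cube(2)[OF b]
      using profile_gap_oscillation[OF p q(1) gap_index_D(1)[OF m], folded F_def] l
      by (intro mult_left_mono) auto
  qed
  have sum_bound: "(\<Sum>k<N. real (Suc k) powr (- q / p)) \<le> K powr q / c" for N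
  proof -
    define S where "S = Sigma {..<N} (gap_index i)"
    have "finite S" unfolding S_def by (intro finite_SigmaI) (auto simp: finite_gap_index)
    have inj: "inj_on (gap_cube a l) S"
    proof (rule inj_onI)
      fix z z' assume z: "z \<in> S" "z' \<in> S" "gap_cube a l z = gap_cube a l z'"
      obtain k m k' m' where km: "z = (k, m)" "z' = (k', m')" by (cases z, cases z') auto
      with z have "m \<in> gap_index i k" "m' \<in> gap_index i k'" by (auto simp: S_def)
      with gap_cubes_disjoint[OF l this] gap_cube_between(4)[OF Q0 this(1)] z(3) show "z = z'"
        unfolding km by blast
    qed
    have "pairwise disjnt (gap_cube a l ` S)"
    proof (rule pairwiseI)
      fix Q Q' assume "Q \<in> gap_cube a l ` S" "Q' \<in> gap_cube a l ` S" "Q \<noteq> Q'"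
      then obtain k m k' m' where Q: "Q = gap_cube a l (k, m)" "Q' = gap_cube a l (k', m')"
        and m: "m \<in> gap_index i k" "m' \<in> gap_index i k'" by (auto simp: S_def)
      show "disjnt Q Q'"
        using gap_cubes_disjoint[OF l m] \<open>Q \<noteq> Q'\<close> unfolding Q disjnt_def by blast
    qed
    moreover have "\<forall>Q\<in>gap_cube a l ` S. is_cube Q \<and> Q \<subseteq> Q\<^sub>0"
      using gap_cube_between(2,3)[OF Q0] by (auto simp: S_def)
    ultimately have "(\<Sum>\<^sub>\<infinity>Q\<in>gap_cube a l ` S. ennreal (osc Q)) \<le> ennreal (K powr q)"
      using \<open>finite S\<close> by (intro K) (auto intro: countable_finite)
    also have "(\<Sum>\<^sub>\<infinity>Q\<in>gap_cube a l ` S. ennreal (osc Q)) = (\<Sum>z\<in>S. ennreal (osc (gap_cube a l z)))"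
      using \<open>finite S\<close> by (simp add: sum.reindex[OF inj])
    also have "\<dots> = ennreal (\<Sum>z\<in>S. osc (gap_cube a l z))"
      by (intro sum_ennreal) (simp add: osc_def)
    finally have "(\<Sum>z\<in>S. osc (gap_cube a l z)) \<le> K powr q"
      by (simp add: ennreal_le_iff)
    moreover have "(\<Sum>z\<in>S. osc (gap_cube a l z)) = (\<Sum>k<N. \<Sum>m\<in>gap_index i k. osc (gap_cube a l (k, m)))"
      unfolding S_def by (subst sum.Sigma) (auto simp: finite_gap_index)
    moreover have "c * real (Suc k) powr (- q / p) \<le> (\<Sum>m\<in>gap_index i k. osc (gap_cube a l (k, m)))" for k
    proof -
      have "(4::real) ^ k = 2 ^ k * 2 ^ k" by (simp add: power_mult_distrib[symmetric])
      moreover have "((4::real) ^ k) ^ CARD('n) = 4 ^ k * (4 ^ k) ^ (CARD('n) - 1)"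
        by (metis One_nat_def Suc_pred power_Suc zero_less_card_finite)
      moreover have "(l / (2 * 4 ^ k)) ^ CARD('n) = (l / 2) ^ CARD('n) / (4 ^ k) ^ CARD('n)"
        by (simp add: power_divide power_mult_distrib)
      ultimately have "c * real (Suc k) powr (- q / p) = real (card (gap_index i k)) *
        ((l / (2 * 4 ^ k)) ^ CARD('n) * ((ln 2 / (2 * q)) powr q * 2 ^ k * real (Suc k) powr (- q / p)))"
        unfolding card_gap_index c_def by simp
      also have "\<dots> \<le> (\<Sum>m\<in>gap_index i k. osc (gap_cube a l (k, m)))"
        by (intro sum_bounded_below osc_ge)
      finally show ?thesis .
    qed
    then have "c * (\<Sum>k<N. real (Suc k) powr (- q / p)) \<le> (\<Sum>k<N. \<Sum>m\<in>gap_index i k. osc (gap_cube a l (k, m)))"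
      unfolding sum_distrib_left by (intro sum_mono)
    ultimately have "c * (\<Sum>k<N. real (Suc k) powr (- q / p)) \<le> K powr q" by simp
    then show ?thesis using \<open>0 < c\<close> by (simp add: field_simps)
  qed
  have "summable (\<lambda>k. real (Suc k) powr (- q / p))"
    by (rule summableI_nonneg_bounded[OF _ sum_bound]) simp
  then have "summable (\<lambda>k. real k powr (- q / p))"
    using summable_Suc_iff[of "\<lambda>k. real k powr (- q / p)"] by simp
  then have "- q / p < -1" using summable_real_powr_iff[of "- q / p"] by simp
  then show False using p q by (simp add: field_simps)
qed

theorem corollary3p14:
  fixes Q\<^sub>0 :: "(real ^ 'n) set" and p :: real
  assumes "is_cube Q\<^sub>0" and "1 < p"
  shows "\<exists>f :: real ^ 'n \<Rightarrow> real.
           (\<forall>x\<in>Q\<^sub>0. 0 \<le> f x) \<and>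
           (\<forall>q. 1 < q \<and> q \<le> p \<longrightarrow> (\<lambda>x. f x powr (1 / q)) \<notin> JN q Q\<^sub>0) \<and>
           (\<forall>q. p < q \<longrightarrow> (\<lambda>x. f x powr (1 / q)) \<in> JN q Q\<^sub>0)"
proof -
  obtain a l where Q0: "cube_between a l Q\<^sub>0" using is_cube_between[OF assms(1)] .
  obtain i :: 'n where True by simp
  show ?thesis
    using coordinate_profile_in_JN[OF Q0 assms(2), where i = i] coordinate_profile_notin_JN[OF Q0 assms(2), where i = i]
    by (intro exI[of _ "\<lambda>x. profile p ((x $ i - a $ i) / l)"]) (auto simp: profile_nonneg)
qed

end
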